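(* Let $p \neq 3$ be a prime. There is no non-abelian $p$-group $G$ of order $p^n$ having nilpotency class $c \geq 3$ with $|G'| = p^k$ and $|M(G)| = p^{\frac{1}{2}(n+k-2)(n-k-1)+1}$. In particular, for every prime $p \neq 3$ and every $p$-group $G$ of order $p^n$ and nilpotency class $c \geq 3$ with $|G'| = p^k$, one has $$|M(G)| \leq p^{\frac{1}{2}(n+k-2)(n-k-1)}.$$
   Context: For a finite group $G$, $M(G)$ denotes the Schur multiplier of $G$ and $G'$ denotes the derived (commutator) subgroup of $G$. *)

theory Defs
  imports Complex_Main "HOL-Computational_Algebra.Primes" "HOL-Algebra.Coset"
    "HOL-Algebra.Generated_Groups"
begin

section \<open>The Schur multiplier\<close>

text \<open>For a finite group $G$ the Schur multiplier is $M(G) = H^2(G, \mathbb{C}^{\times})$ with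
  trivial action. Cochains are extensional functions on \<open>carrier G \<times> carrier G\<close>, so that equality
  of cochains is equality on that set.\<close>

definition cocycles2 :: "('a, 'b) monoid_scheme \<Rightarrow> ('a \<times> 'a \<Rightarrow> complex) set" where
  "cocycles2 G = {f \<in> (carrier G \<times> carrier G) \<rightarrow>\<^sub>E (UNIV - {0}).
     \<forall>x\<in>carrier G. \<forall>y\<in>carrier G. \<forall>z\<in>carrier G.
       f (x, y) * f (x \<otimes>\<^bsub>G\<^esub> y, z) = f (y, z) * f (x, y \<otimes>\<^bsub>G\<^esub> z)}"

definition coboundary2 :: "('a, 'b) monoid_scheme \<Rightarrow> ('a \<Rightarrow> complex) \<Rightarrow> 'a \<times> 'a \<Rightarrow> complex" where
  "coboundary2 G u = (\<lambda>(x, y)\<in>carrier G \<times> carrier G. u x * u y / u (x \<otimes>\<^bsub>G\<^esub> y))"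

definition coboundaries2 :: "('a, 'b) monoid_scheme \<Rightarrow> ('a \<times> 'a \<Rightarrow> complex) set" where
  "coboundaries2 G = {coboundary2 G u |u. u \<in> carrier G \<rightarrow> UNIV - {0}}"

definition cocycle_group2 :: "('a, 'b) monoid_scheme \<Rightarrow> ('a \<times> 'a \<Rightarrow> complex) monoid" where
  "cocycle_group2 G =
     \<lparr>carrier = cocycles2 G,
      mult = (\<lambda>f g. \<lambda>s\<in>carrier G \<times> carrier G. f s * g s),
      one = (\<lambda>s\<in>carrier G \<times> carrier G. 1)\<rparr>"

definition schur_multiplier :: "('a, 'b) monoid_scheme \<Rightarrow> ('a \<times> 'a \<Rightarrow> complex) set monoid" where
  "schur_multiplier G = cocycle_group2 G Mod coboundaries2 G"

section \<open>Nilpotency class\<close>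

text \<open>The index is shifted: \<open>lower_central G i\<close> is $\gamma_{i+1}(G)$, so \<open>lower_central G 0\<close> is
  $G$ itself and \<open>lower_central G 1\<close> is $G'$. Commutators follow the convention of
  \<^const>\<open>derived\<close>.\<close>

primrec lower_central :: "('a, 'b) monoid_scheme \<Rightarrow> nat \<Rightarrow> 'a set" where
  "lower_central G 0 = carrier G"
| "lower_central G (Suc i) =
     generate G (\<Union>x\<in>lower_central G i. \<Union>y\<in>carrier G.
       {x \<otimes>\<^bsub>G\<^esub> y \<otimes>\<^bsub>G\<^esub> inv\<^bsub>G\<^esub> x \<otimes>\<^bsub>G\<^esub> inv\<^bsub>G\<^esub> y})"

definition has_nilpotency_class :: "('a, 'b) monoid_scheme \<Rightarrow> nat \<Rightarrow> bool" where
  "has_nilpotency_class G c \<longleftrightarrow>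
     lower_central G c = {\<one>\<^bsub>G\<^esub>} \<and> (\<forall>i<c. lower_central G i \<noteq> {\<one>\<^bsub>G\<^esub>})"

lemma lower_central_1: "lower_central G (Suc 0) = derived G (carrier G)"
  by (simp add: derived_def)

section \<open>The Schur multiplier of a finite group is a finite abelian group\<close>

text \<open>These facts make the quotient above meaningful; finiteness ensures that
  \<open>order (schur_multiplier G)\<close> is a genuine cardinality and not the default value \<open>0\<close>.\<close>

lemma cocycles2D:
  assumes "f \<in> cocycles2 G" "x \<in> carrier G" "y \<in> carrier G"
  shows "f (x, y) \<noteq> 0"
    and "z \<in> carrier G \<Longrightarrow> f (x, y) * f (x \<otimes>\<^bsub>G\<^esub> y, z) = f (y, z) * f (x, y \<otimes>\<^bsub>G\<^esub> z)"
  using assms by (auto simp: cocycles2_def)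

lemma coboundaries2I:
  assumes "\<And>x. x \<in> carrier G \<Longrightarrow> u x \<noteq> 0"
  shows "coboundary2 G u \<in> coboundaries2 G"
  using assms unfolding coboundaries2_def by blast

lemma (in group) cocycle_group2_comm_group: "comm_group (cocycle_group2 G)"
proof (rule comm_groupI)
  fix f assume f: "f \<in> carrier (cocycle_group2 G)"
  let ?g = "\<lambda>s\<in>carrier G \<times> carrier G. inverse (f s)"
  have "?g \<in> cocycles2 G"
    using f cocycles2D[of f G]
    by (auto simp: cocycles2_def cocycle_group2_def simp flip: inverse_mult_distrib)
  moreover have "?g \<otimes>\<^bsub>cocycle_group2 G\<^esub> f = \<one>\<^bsub>cocycle_group2 G\<^esub>"
    using f cocycles2D[of f G] by (auto simp: cocycle_group2_def fun_eq_iff restrict_def)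
  ultimately show "\<exists>g\<in>carrier (cocycle_group2 G). g \<otimes>\<^bsub>cocycle_group2 G\<^esub> f = \<one>\<^bsub>cocycle_group2 G\<^esub>"
    by (intro bexI[of _ ?g]) (simp_all add: cocycle_group2_def)
next
  fix f g assume fg: "f \<in> carrier (cocycle_group2 G)" "g \<in> carrier (cocycle_group2 G)"
  have "f (x, y) * g (x, y) * (f (x \<otimes> y, z) * g (x \<otimes> y, z)) =
      f (y, z) * g (y, z) * (f (x, y \<otimes> z) * g (x, y \<otimes> z))"
    if xyz: "x \<in> carrier G" "y \<in> carrier G" "z \<in> carrier G" for x y z
  proof -
    have "(f (x, y) * f (x \<otimes> y, z)) * (g (x, y) * g (x \<otimes> y, z)) =
        (f (y, z) * f (x, y \<otimes> z)) * (g (y, z) * g (x, y \<otimes> z))"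
      using fg xyz cocycles2D(2)[of f G x y z] cocycles2D(2)[of g G x y z]
      by (simp add: cocycle_group2_def)
    then show ?thesis by (simp only: mult_ac)
  qed
  with fg show "f \<otimes>\<^bsub>cocycle_group2 G\<^esub> g \<in> carrier (cocycle_group2 G)"
    using cocycles2D(1)[of f G] cocycles2D(1)[of g G]
    by (auto simp: cocycle_group2_def cocycles2_def)
next
  show "\<one>\<^bsub>cocycle_group2 G\<^esub> \<in> carrier (cocycle_group2 G)"
    by (auto simp: cocycle_group2_def cocycles2_def)
qed (auto simp: cocycle_group2_def cocycles2_def fun_eq_iff restrict_def PiE_def extensional_def)

lemma (in group) coboundaries2_subset: "coboundaries2 G \<subseteq> cocycles2 G"
proof
  fix f assume "f \<in> coboundaries2 G"
  then obtain u where u: "f = coboundary2 G u" "\<And>x. x \<in> carrier G \<Longrightarrow> u x \<noteq> 0"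
    by (auto simp: coboundaries2_def)
  then show "f \<in> cocycles2 G"
    by (auto simp: cocycles2_def coboundary2_def m_assoc)
qed

lemma (in group) coboundaries2_subgroup: "subgroup (coboundaries2 G) (cocycle_group2 G)"
proof -
  interpret Z: comm_group "cocycle_group2 G" by (rule cocycle_group2_comm_group)
  show ?thesis
  proof (rule Z.subgroupI)
    show "coboundaries2 G \<subseteq> carrier (cocycle_group2 G)"
      using coboundaries2_subset by (simp add: cocycle_group2_def)
    have "coboundary2 G (\<lambda>_. 1) \<in> coboundaries2 G"
      by (rule coboundaries2I) (rule one_neq_zero)
    then show "coboundaries2 G \<noteq> {}" by blast
  next
    fix f assume "f \<in> coboundaries2 G"
    then obtain u where u: "f = coboundary2 G u" "\<And>x. x \<in> carrier G \<Longrightarrow> u x \<noteq> 0"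
      by (auto simp: coboundaries2_def)
    let ?g = "coboundary2 G (\<lambda>x. inverse (u x))"
    have g: "?g \<in> coboundaries2 G" using u by (intro coboundaries2I) auto
    have "?g \<otimes>\<^bsub>cocycle_group2 G\<^esub> f = \<one>\<^bsub>cocycle_group2 G\<^esub>"
      using u by (auto simp: cocycle_group2_def coboundary2_def fun_eq_iff restrict_def field_simps)
    then have "inv\<^bsub>cocycle_group2 G\<^esub> f = ?g"
      using g coboundaries2_subset \<open>f \<in> coboundaries2 G\<close>
      by (intro Z.inv_equality) (auto simp: cocycle_group2_def)
    with g show "inv\<^bsub>cocycle_group2 G\<^esub> f \<in> coboundaries2 G" by simp
  next
    fix f g assume "f \<in> coboundaries2 G" "g \<in> coboundaries2 G"
    then obtain u v where uv: "f = coboundary2 G u" "g = coboundary2 G v"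
      "\<And>x. x \<in> carrier G \<Longrightarrow> u x \<noteq> 0" "\<And>x. x \<in> carrier G \<Longrightarrow> v x \<noteq> 0"
      by (auto simp: coboundaries2_def)
    then have "f \<otimes>\<^bsub>cocycle_group2 G\<^esub> g = coboundary2 G (\<lambda>x. u x * v x)"
      by (auto simp: cocycle_group2_def coboundary2_def fun_eq_iff restrict_def)
    with uv show "f \<otimes>\<^bsub>cocycle_group2 G\<^esub> g \<in> coboundaries2 G"
      by (auto intro!: coboundaries2I)
  qed
qed

lemma (in group) schur_multiplier_comm_group: "comm_group (schur_multiplier G)"
  unfolding schur_multiplier_def
  using comm_group.abelian_FactGroup[OF cocycle_group2_comm_group coboundaries2_subgroup] .

lemma (in group) finite_schur_multiplier:
  assumes fin: "finite (carrier G)"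
  shows "finite (carrier (schur_multiplier G))"
proof -
  interpret Z: comm_group "cocycle_group2 G" by (rule cocycle_group2_comm_group)
  let ?m = "card (carrier G)"
  let ?R = "(carrier G \<times> carrier G) \<rightarrow>\<^sub>E {z :: complex. z ^ ?m = 1}"
  have m: "?m > 0" using fin by (auto simp: card_gt_0_iff)
  have "coboundaries2 G #>\<^bsub>cocycle_group2 G\<^esub> f \<in>
      (\<lambda>g. coboundaries2 G #>\<^bsub>cocycle_group2 G\<^esub> g) ` ?R" if f: "f \<in> cocycles2 G" for f
  proof -
    define u where "u x = (\<Prod>z\<in>carrier G. f (x, z))" for x
    have u0: "u x \<noteq> 0" if "x \<in> carrier G" for x
      using that cocycles2D(1)[OF f] fin by (simp add: u_def)
    have pow: "f (x, y) ^ ?m * u (x \<otimes> y) = u x * u y"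
      if xy: "x \<in> carrier G" "y \<in> carrier G" for x y
    proof -
      have "f (x, y) ^ ?m * u (x \<otimes> y) = (\<Prod>z\<in>carrier G. f (x, y) * f (x \<otimes> y, z))"
        by (simp add: u_def prod.distrib)
      also have "\<dots> = (\<Prod>z\<in>carrier G. f (y, z) * f (x, y \<otimes> z))"
        by (intro prod.cong refl cocycles2D(2)[OF f xy])
      also have "\<dots> = u y * (\<Prod>z\<in>carrier G. f (x, y \<otimes> z))"
        by (simp add: u_def prod.distrib)
      also have "(\<Prod>z\<in>carrier G. f (x, y \<otimes> z)) = u x"
        unfolding u_def
        by (rule prod.reindex_bij_witness[of _ "\<lambda>z. inv y \<otimes> z" "\<lambda>z. y \<otimes> z"])
          (use xy in \<open>auto simp flip: m_assoc\<close>)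
      finally show ?thesis by (simp add: mult.commute)
    qed
    have "\<exists>w. w ^ ?m = inverse (u x)" if "x \<in> carrier G" for x
    proof -
      have "card {w. w ^ ?m = inverse (u x)} = ?m"
        using u0[OF that] m by (intro card_nth_roots) auto
      with m have "{w. w ^ ?m = inverse (u x)} \<noteq> {}" by (metis card.empty less_irrefl)
      then show ?thesis by blast
    qed
    then obtain v where v: "\<And>x. x \<in> carrier G \<Longrightarrow> v x ^ ?m = inverse (u x)" by metis
    have v0: "v x \<noteq> 0" if "x \<in> carrier G" for x
      using v[OF that] u0[OF that] m by (auto simp: power_0_left)
    have b: "coboundary2 G v \<in> coboundaries2 G" using v0 by (intro coboundaries2I)
    define g where "g = coboundary2 G v \<otimes>\<^bsub>cocycle_group2 G\<^esub> f"
    have "g \<in> ?R"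
    proof (rule PiE_I)
      fix s assume "s \<in> carrier G \<times> carrier G"
      then obtain x y where s: "s = (x, y)" and xy: "x \<in> carrier G" "y \<in> carrier G" by auto
      have "g s ^ ?m = inverse (u x) * inverse (u y) / inverse (u (x \<otimes> y)) * f (x, y) ^ ?m"
        using xy by (simp add: g_def s cocycle_group2_def coboundary2_def power_mult_distrib
            power_divide v)
      also have "\<dots> = 1"
        using pow[OF xy] u0 xy by (simp add: field_simps)
      finally show "g s \<in> {z. z ^ ?m = 1}" by simp
    qed (auto simp: g_def cocycle_group2_def)
    moreover have "coboundaries2 G #>\<^bsub>cocycle_group2 G\<^esub> f = coboundaries2 G #>\<^bsub>cocycle_group2 G\<^esub> g"
      using f b by (intro Z.repr_independence coboundaries2_subgroup)
        (auto simp: g_def r_coset_def cocycle_group2_def)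
    ultimately show ?thesis by blast
  qed
  then have "carrier (schur_multiplier G) \<subseteq>
      (\<lambda>g. coboundaries2 G #>\<^bsub>cocycle_group2 G\<^esub> g) ` ?R"
    by (auto simp: schur_multiplier_def FactGroup_def RCOSETS_def cocycle_group2_def)
  moreover have "finite ?R"
    using fin m by (intro finite_PiE finite_roots_unity) auto
  ultimately show ?thesis using finite_subset finite_imageI by metis
qed

end

theory Submission
  imports Defs "HOL-Algebra.Multiplicative_Group"
begin

text \<open>
  Write $n = m + k$, so that $|G / G'| = p^m$ and $|G'| = p^k$; the exponent in question is
  $\binom{m-1}{2} + k (m - 1)$. Everything is an induction along quotients by central subgroups.
  Let $K = \langle z \rangle \le G'$ be central of order $p$. A cocycle $f$ defines a central extension
  of $G$ by $\mathbb{C}^\times$, and the commutators of lifts of $z$ with lifts of elements of $G$ give a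
  character $\chi_f = f(z, \cdot) / f(\cdot, z)$ of $G$ whose values are $p$-th roots of unity. If
  $\chi_f$ is trivial then $f$ is cohomologous to a cocycle inflated from $G / K$, and inflation kills the $p$ classes that are
  transgressions of characters of $K$. Hence
  \[ |M(G)| \cdot p \le |M(G/K)| \cdot |\{\chi_f\}| \]
  (\<open>order_schur_multiplier_le_quotient_derived\<close>).
  There are at most $p^m$ characters $\chi_f$, because they are trivial on $G'$, and so a step of the
  induction costs at most a factor $p^{m-1}$. This is exactly the growth of the exponent with $k$, so a
  single improvement anywhere along the induction improves the final bound.

  The Hall-Witt identity in the extension restricts $\chi_f$ further. If $K = G'$ then $\chi_f$ is
  determined by two values, and starting from the bound $p^{\binom{m}{2}}$ for the multiplier of the abelian
  group $G / G'$ one obtains $|M(G)| \le p^{\binom{m-1}{2} + k(m-1) + 1}$ for all non-abelian nilpotent $G$ of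
  order $p^n$ (\<open>schur_multiplier_nonabelian_bound\<close>).

  The remaining factor $p$ is saved at the moment when $\gamma_3(G)$ is the central subgroup $K$ of
  order $p$. The map $(a, b, c) \mapsto [[a,b],c]$ is then trilinear, alternating in $a, b$, and
  satisfies the Jacobi identity. If $[[a,b],b] = 1$ held for all $a, b$, it would be alternating in
  all three variables and the Jacobi identity would give $[[a,b],c]^3 = 1$, that is, $\gamma_3(G) = 1$ for
  $p \neq 3$. So for $p \neq 3$ there are $a, b$ such that $z = [[a,b],b] \neq 1$ generates $K$. Two
  applications of Hall-Witt now show that $\chi_f$ is determined by $\chi_f(a)$ and $\chi_f(b)$, and by
  $\chi_f(b)$ alone when $p$ is odd. Therefore there are at most $p^{m-1}$ characters $\chi_f$ unless $p = m = 2$, and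
  in that case the factor $2$ is already saved at a non-abelian quotient of order $8$
  (\<open>schur_multiplier_bound_2_rank_2\<close>).
\<close>

section \<open>Commutators and the Hall-Witt identity\<close>

context group
begin

definition commutator :: "'a \<Rightarrow> 'a \<Rightarrow> 'a" where
  "commutator x y = x \<otimes> y \<otimes> inv x \<otimes> inv y"

definition conjugate :: "'a \<Rightarrow> 'a \<Rightarrow> 'a" where
  "conjugate y x = y \<otimes> x \<otimes> inv y"

definition central :: "'a \<Rightarrow> bool" where
  "central z \<longleftrightarrow> z \<in> carrier G \<and> (\<forall>g\<in>carrier G. z \<otimes> g = g \<otimes> z)"

lemma commutator_closed [simp, intro]:
  "x \<in> carrier G \<Longrightarrow> y \<in> carrier G \<Longrightarrow> commutator x y \<in> carrier G"
  by (simp add: commutator_def)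

lemma conjugate_closed [simp, intro]:
  "y \<in> carrier G \<Longrightarrow> x \<in> carrier G \<Longrightarrow> conjugate y x \<in> carrier G"
  by (simp add: conjugate_def)

lemma mult_inv_cancel:
  "x \<in> carrier G \<Longrightarrow> y \<in> carrier G \<Longrightarrow> x \<otimes> (inv x \<otimes> y) = y"
  "x \<in> carrier G \<Longrightarrow> y \<in> carrier G \<Longrightarrow> inv x \<otimes> (x \<otimes> y) = y"
  by (simp_all flip: m_assoc)

text \<open>With the simplifier's own rules for inverses these equations decide every identity between words in
  a free group.\<close>

lemmas word_simps = commutator_def conjugate_def m_assoc inv_mult_group mult_inv_cancel

text \<open>With conjugates in the second place the identity contains no inverses, so that it can be used for
  lifts of given elements without choosing lifts of their inverses.\<close>

lemma hall_witt:
  assumes "x \<in> carrier G" "y \<in> carrier G" "z \<in> carrier G"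
  shows "commutator (commutator x y) (conjugate y z) \<otimes> commutator (commutator y z) (conjugate z x)
    \<otimes> commutator (commutator z x) (conjugate x y) = \<one>"
  using assms by (simp add: word_simps)

lemma commutator_eq_one_iff:
  assumes "x \<in> carrier G" "y \<in> carrier G"
  shows "commutator x y = \<one> \<longleftrightarrow> x \<otimes> y = y \<otimes> x"
proof -
  have "commutator x y = (x \<otimes> y) \<otimes> inv (y \<otimes> x)"
    using assms by (simp add: word_simps)
  then show ?thesis using assms
    by (metis inv_closed inv_equality inv_inv m_closed r_inv)
qed

lemma inv_commutator:
  "x \<in> carrier G \<Longrightarrow> y \<in> carrier G \<Longrightarrow> inv (commutator x y) = commutator y x"
  by (simp add: word_simps)

lemma commutator_mult_right:
  assumes "x \<in> carrier G" "y \<in> carrier G" "z \<in> carrier G"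
  shows "commutator x (y \<otimes> z) = commutator x y \<otimes> conjugate y (commutator x z)"
  using assms by (simp add: word_simps)

lemma commutator_mult_left:
  assumes "x \<in> carrier G" "y \<in> carrier G" "z \<in> carrier G"
  shows "commutator (x \<otimes> y) z = conjugate x (commutator y z) \<otimes> commutator x z"
  using assms by (simp add: word_simps)

lemma conjugate_eq_commutator_mult:
  assumes "x \<in> carrier G" "y \<in> carrier G"
  shows "conjugate y x = commutator y x \<otimes> x"
  using assms by (simp add: word_simps)

lemma centralD: "central z \<Longrightarrow> z \<in> carrier G" "central z \<Longrightarrow> g \<in> carrier G \<Longrightarrow> z \<otimes> g = g \<otimes> z"
  by (auto simp: central_def)

lemma conjugate_central: "central z \<Longrightarrow> g \<in> carrier G \<Longrightarrow> conjugate g z = z"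
  by (metis centralD conjugate_def inv_solve_right m_closed)

lemma central_mult [simp]:
  assumes "central x" "central y" shows "central (x \<otimes> y)"
  using assms unfolding central_def by (metis m_assoc m_closed)

lemma central_inv [simp]:
  assumes "central x" shows "central (inv x)"
  using assms unfolding central_def
  by (metis inv_closed inv_solve_left inv_solve_right m_assoc m_closed)

lemma central_one [simp]: "central \<one>" by (simp add: central_def)

lemma commutator_central_left: "central z \<Longrightarrow> g \<in> carrier G \<Longrightarrow> commutator z g = \<one>"
  by (simp add: commutator_eq_one_iff centralD)

end

section \<open>Cocycles and the commutator pairing of a central extension\<close>

text \<open>Unlike in \<^const>\<open>cocycles2\<close>, values outside the carrier are arbitrary, so that products,
  quotients and inflations of cocycles are cocycles without being restricted again.\<close>

definition cocycle :: "('a, 'b) monoid_scheme \<Rightarrow> ('a \<times> 'a \<Rightarrow> complex) \<Rightarrow> bool" where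
  "cocycle G f \<longleftrightarrow> (\<forall>x\<in>carrier G. \<forall>y\<in>carrier G. f (x, y) \<noteq> 0) \<and>
     (\<forall>x\<in>carrier G. \<forall>y\<in>carrier G. \<forall>z\<in>carrier G.
       f (x, y) * f (x \<otimes>\<^bsub>G\<^esub> y, z) = f (y, z) * f (x, y \<otimes>\<^bsub>G\<^esub> z))"

lemma cocycleD:
  assumes "cocycle G f" "x \<in> carrier G" "y \<in> carrier G"
  shows "f (x, y) \<noteq> 0"
    and "z \<in> carrier G \<Longrightarrow> f (x, y) * f (x \<otimes>\<^bsub>G\<^esub> y, z) = f (y, z) * f (x, y \<otimes>\<^bsub>G\<^esub> z)"
  using assms by (auto simp: cocycle_def)

lemma cocycles2_cocycle: "f \<in> cocycles2 G \<Longrightarrow> cocycle G f"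
  by (auto simp: cocycles2_def cocycle_def)

text \<open>For commuting $g$ and $h$ this is the commutator of lifts of $g$ and $h$ to the central extension
  defined by $f$, and depends only on the class of $f$.\<close>

definition pairing :: "('a \<times> 'a \<Rightarrow> complex) \<Rightarrow> 'a \<Rightarrow> 'a \<Rightarrow> complex" where
  "pairing f g h = f (g, h) / f (h, g)"

lemma inverse_pairing: "inverse (pairing f g h) = pairing f h g"
  by (simp add: pairing_def)

lemma pairing_self:
  "cocycle G f \<Longrightarrow> g \<in> carrier G \<Longrightarrow> pairing f g g = 1"
  by (simp add: pairing_def cocycleD(1))

context group
begin

lemma cocycle_one:
  assumes "cocycle G f" "g \<in> carrier G"
  shows "f (\<one>, g) = f (\<one>, \<one>)" "f (g, \<one>) = f (\<one>, \<one>)"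
  using cocycleD(2)[OF assms(1), of \<one> \<one> g] cocycleD(2)[OF assms(1), of g \<one> \<one>]
    cocycleD(1)[OF assms(1), of \<one> g] cocycleD(1)[OF assms(1), of g \<one>] assms(2) by auto

lemma pairing_one:
  assumes "cocycle G f" "g \<in> carrier G"
  shows "pairing f \<one> g = 1" "pairing f g \<one> = 1"
  using cocycle_one[OF assms] cocycleD(1)[OF assms(1), of \<one> \<one>] by (auto simp: pairing_def)

lemma pairing_nonzero:
  "cocycle G f \<Longrightarrow> g \<in> carrier G \<Longrightarrow> h \<in> carrier G \<Longrightarrow> pairing f g h \<noteq> 0"
  by (simp add: pairing_def cocycleD)

text \<open>Commutators of lifts are bimultiplicative where they are central. The proof combines the cocycle
  identities for the three orders $(g,h,k)$, $(h,k,g)$ and $(h,g,k)$.\<close>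

lemma pairing_mult_right:
  assumes f: "cocycle G f" and c: "g \<in> carrier G" "h \<in> carrier G" "k \<in> carrier G"
    and comm: "g \<otimes> h = h \<otimes> g" "g \<otimes> k = k \<otimes> g"
  shows "pairing f g (h \<otimes> k) = pairing f g h * pairing f g k"
proof -
  note nz = cocycleD(1)[OF f]
  have 1: "f (g, h) * f (g \<otimes> h, k) = f (h, k) * f (g, h \<otimes> k)"
    using cocycleD(2)[OF f] c by blast
  have 2: "f (h, k) * f (h \<otimes> k, g) = f (k, g) * f (h, g \<otimes> k)"
    using cocycleD(2)[OF f, of h k g] c comm by simp
  have 3: "f (h, g) * f (g \<otimes> h, k) = f (g, k) * f (h, g \<otimes> k)"
    using cocycleD(2)[OF f, of h g k] c comm by simp
  have "f (g, h \<otimes> k) = f (g, h) * f (g \<otimes> h, k) / f (h, k)"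
    using 1 nz c by (simp add: field_simps)
  moreover have "f (h \<otimes> k, g) = f (k, g) * f (h, g \<otimes> k) / f (h, k)"
    using 2 nz c by (simp add: field_simps)
  moreover have "f (g \<otimes> h, k) = f (g, k) * f (h, g \<otimes> k) / f (h, g)"
    using 3 nz c by (simp add: field_simps)
  ultimately show ?thesis
    using nz c by (simp add: pairing_def)
qed

lemma pairing_mult_left:
  assumes f: "cocycle G f" and c: "g \<in> carrier G" "h \<in> carrier G" "k \<in> carrier G"
    and comm: "h \<otimes> g = g \<otimes> h" "k \<otimes> g = g \<otimes> k"
  shows "pairing f (h \<otimes> k) g = pairing f h g * pairing f k g"
  using pairing_mult_right[OF f c] comm inverse_pairing
  by (metis inverse_mult_distrib)

lemma pairing_pow_left:
  assumes f: "cocycle G f" and c: "g \<in> carrier G" "h \<in> carrier G" and comm: "h \<otimes> g = g \<otimes> h"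
  shows "pairing f (h [^] (i::nat)) g = pairing f h g ^ i"
proof (induction i)
  case 0
  then show ?case using pairing_one[OF f] c by simp
next
  case (Suc i)
  have "h [^] i \<otimes> g = g \<otimes> h [^] i" using comm c by (metis pow_mult_distrib group_commutes_pow)
  then show ?case using Suc pairing_mult_left[OF f c(1) _ c(2), of "h [^] i"] comm c by simp
qed

end

text \<open>The extension of $G$ by $\mathbb{C}^\times$ with cocycle $f$. Since $f$ need not be normalised, the neutral
  element has first coordinate $1 / f(1,1)$.\<close>

definition extension :: "('a, 'b) monoid_scheme \<Rightarrow> ('a \<times> 'a \<Rightarrow> complex) \<Rightarrow> (complex \<times> 'a) monoid" where
  "extension G f = \<lparr>carrier = (UNIV - {0}) \<times> carrier G,
     mult = (\<lambda>(a, g) (b, h). (a * b * f (g, h), g \<otimes>\<^bsub>G\<^esub> h)),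
     one = (1 / f (\<one>\<^bsub>G\<^esub>, \<one>\<^bsub>G\<^esub>), \<one>\<^bsub>G\<^esub>)\<rparr>"

context group
begin

lemma extension_group:
  assumes f: "cocycle G f"
  shows "group (extension G f)"
proof (rule groupI)
  note nz = cocycleD(1)[OF f]
  note one = cocycle_one[OF f]
  fix u v w assume "u \<in> carrier (extension G f)" "v \<in> carrier (extension G f)" "w \<in> carrier (extension G f)"
  moreover obtain a b c x y z where "u = (a, x)" "v = (b, y)" "w = (c, z)"
    by (metis surj_pair)
  ultimately have u: "u = (a, x)" "v = (b, y)" "w = (c, z)"
     "x \<in> carrier G" "y \<in> carrier G" "z \<in> carrier G" "a \<noteq> 0" "b \<noteq> 0" "c \<noteq> 0"
    by (auto simp: extension_def)
  show "u \<otimes>\<^bsub>extension G f\<^esub> v \<in> carrier (extension G f)"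
    using u nz by (simp add: extension_def)
  show "u \<otimes>\<^bsub>extension G f\<^esub> v \<otimes>\<^bsub>extension G f\<^esub> w = u \<otimes>\<^bsub>extension G f\<^esub> (v \<otimes>\<^bsub>extension G f\<^esub> w)"
    using u cocycleD(2)[OF f, of x y z] by (simp add: extension_def m_assoc mult_ac)
  show "\<one>\<^bsub>extension G f\<^esub> \<otimes>\<^bsub>extension G f\<^esub> u = u"
    using u nz[of \<one> \<one>] one(1)[of x] by (simp add: extension_def)
next
  note nz = cocycleD(1)[OF f]
  fix u assume "u \<in> carrier (extension G f)"
  then obtain a x where u: "u = (a, x)" "x \<in> carrier G" "a \<noteq> 0"
    by (auto simp: extension_def)
  let ?v = "(1 / (a * f (\<one>, \<one>) * f (inv x, x)), inv x)"
  have "?v \<in> carrier (extension G f)" "?v \<otimes>\<^bsub>extension G f\<^esub> u = \<one>\<^bsub>extension G f\<^esub>"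
    using u nz[of \<one> \<one>] nz[of "inv x" x] by (simp_all add: extension_def)
  then show "\<exists>v\<in>carrier (extension G f). v \<otimes>\<^bsub>extension G f\<^esub> u = \<one>\<^bsub>extension G f\<^esub>" by blast
next
  show "\<one>\<^bsub>extension G f\<^esub> \<in> carrier (extension G f)"
    using cocycleD(1)[OF f] by (simp add: extension_def)
qed

lemma extension_commutator:
  assumes f: "cocycle G f" and u: "u \<in> carrier (extension G f)" "v \<in> carrier (extension G f)"
    and comm: "snd u \<otimes> snd v = snd v \<otimes> snd u"
  shows "group.commutator (extension G f) u v = (pairing f (snd u) (snd v) / f (\<one>, \<one>), \<one>)"
proof -
  interpret E: group "extension G f" using extension_group[OF f] .
  note nz = cocycleD(1)[OF f]
  let ?t = "(pairing f (snd u) (snd v) / f (\<one>, \<one>), \<one>)"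
  have t: "?t \<in> carrier (extension G f)"
    using u nz by (auto simp: extension_def pairing_def)
  have "u \<otimes>\<^bsub>extension G f\<^esub> v = ?t \<otimes>\<^bsub>extension G f\<^esub> (v \<otimes>\<^bsub>extension G f\<^esub> u)"
  proof -
    obtain a x b y where uv: "u = (a, x)" "v = (b, y)" by (metis surj_pair)
    have "x \<in> carrier G" "y \<in> carrier G" "x \<otimes> y = y \<otimes> x"
      using u comm by (auto simp: uv extension_def)
    then show ?thesis using nz[of y x] nz[of \<one> \<one>] cocycle_one(1)[OF f, of "y \<otimes> x"]
      by (simp add: uv extension_def pairing_def)
  qed
  then have "E.commutator u v =
      ?t \<otimes>\<^bsub>extension G f\<^esub> (v \<otimes>\<^bsub>extension G f\<^esub> u) \<otimes>\<^bsub>extension G f\<^esub> inv\<^bsub>extension G f\<^esub> u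
      \<otimes>\<^bsub>extension G f\<^esub> inv\<^bsub>extension G f\<^esub> v"
    by (simp add: E.commutator_def)
  also have "\<dots> = ?t" using t u by (simp add: E.m_assoc E.mult_inv_cancel)
  finally show ?thesis .
qed

lemma snd_extension_hom:
  assumes f: "cocycle G f" shows "group_hom (extension G f) G snd"
proof -
  have "snd \<in> hom (extension G f) G" by (auto simp: hom_def extension_def)
  then show ?thesis using extension_group[OF f]
    by (simp add: group_hom.intro group_hom_axioms.intro)
qed

text \<open>This is the Hall-Witt identity in the extension: the commuting hypotheses say that all three
  outer commutators lie in $\mathbb{C}^\times$, where they are values of the pairing.\<close>

lemma hall_witt_pairing:
  assumes f: "cocycle G f" and c: "x \<in> carrier G" "y \<in> carrier G" "z \<in> carrier G"
    and comm: "commutator x y \<otimes> conjugate y z = conjugate y z \<otimes> commutator x y"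
      "commutator y z \<otimes> conjugate z x = conjugate z x \<otimes> commutator y z"
      "commutator z x \<otimes> conjugate x y = conjugate x y \<otimes> commutator z x"
  shows "pairing f (commutator x y) (conjugate y z) * pairing f (commutator y z) (conjugate z x)
     * pairing f (commutator z x) (conjugate x y) = 1"
proof -
  interpret S: group_hom "extension G f" G snd using snd_extension_hom[OF f] .
  note nz = cocycleD(1)[OF f]
  have sc: "snd (S.G.commutator u v) = commutator (snd u) (snd v)"
    if "u \<in> carrier (extension G f)" "v \<in> carrier (extension G f)" for u v
    using that by (simp add: commutator_def S.G.commutator_def)
  have sj: "snd (S.G.conjugate u v) = conjugate (snd u) (snd v)"
    if "u \<in> carrier (extension G f)" "v \<in> carrier (extension G f)" for u v
    using that by (simp add: conjugate_def S.G.conjugate_def)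
  have l: "(1, g) \<in> carrier (extension G f)" if "g \<in> carrier G" for g
    using that by (simp add: extension_def)
  have mult: "(a, \<one>) \<otimes>\<^bsub>extension G f\<^esub> (b, \<one>) = (a * b * f (\<one>, \<one>), \<one>)" for a b
    by (simp add: extension_def)
  have one: "\<one>\<^bsub>extension G f\<^esub> = (1 / f (\<one>, \<one>), \<one>)" by (simp add: extension_def)
  show ?thesis
    using S.G.hall_witt[OF l l l, OF c] c comm nz[of \<one> \<one>]
    by (simp add: extension_commutator[OF f] sc sj l mult one)
qed

end

section \<open>Cohomology classes\<close>

definition is_coboundary :: "('a, 'b) monoid_scheme \<Rightarrow> ('a \<times> 'a \<Rightarrow> complex) \<Rightarrow> bool" where
  "is_coboundary G f \<longleftrightarrow> (\<exists>u. (\<forall>x\<in>carrier G. u x \<noteq> 0) \<and>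
     (\<forall>x\<in>carrier G. \<forall>y\<in>carrier G. f (x, y) = u x * u y / u (x \<otimes>\<^bsub>G\<^esub> y)))"

definition cohomologous ::
  "('a, 'b) monoid_scheme \<Rightarrow> ('a \<times> 'a \<Rightarrow> complex) \<Rightarrow> ('a \<times> 'a \<Rightarrow> complex) \<Rightarrow> bool" where
  "cohomologous G f g \<longleftrightarrow> is_coboundary G (\<lambda>s. f s / g s)"

lemma is_coboundary_cong:
  assumes "\<And>x y. x \<in> carrier G \<Longrightarrow> y \<in> carrier G \<Longrightarrow> f (x, y) = g (x, y)" "is_coboundary G f"
  shows "is_coboundary G g"
  using assms unfolding is_coboundary_def by force

lemma is_coboundary_mult:
  assumes "is_coboundary G f" "is_coboundary G g"
  shows "is_coboundary G (\<lambda>s. f s * g s)"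
proof -
  obtain u v where "\<And>x. x \<in> carrier G \<Longrightarrow> u x \<noteq> 0" "\<And>x. x \<in> carrier G \<Longrightarrow> v x \<noteq> 0"
    "\<And>x y. x \<in> carrier G \<Longrightarrow> y \<in> carrier G \<Longrightarrow> f (x, y) = u x * u y / u (x \<otimes>\<^bsub>G\<^esub> y)"
    "\<And>x y. x \<in> carrier G \<Longrightarrow> y \<in> carrier G \<Longrightarrow> g (x, y) = v x * v y / v (x \<otimes>\<^bsub>G\<^esub> y)"
    using assms unfolding is_coboundary_def by metis
  then show ?thesis unfolding is_coboundary_def
    by (intro exI[of _ "\<lambda>x. u x * v x"]) (simp add: mult_ac)
qed

lemma is_coboundary_inverse:
  assumes "is_coboundary G f"
  shows "is_coboundary G (\<lambda>s. inverse (f s))"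
proof -
  obtain u where "\<And>x. x \<in> carrier G \<Longrightarrow> u x \<noteq> 0"
    "\<And>x y. x \<in> carrier G \<Longrightarrow> y \<in> carrier G \<Longrightarrow> f (x, y) = u x * u y / u (x \<otimes>\<^bsub>G\<^esub> y)"
    using assms unfolding is_coboundary_def by metis
  then show ?thesis unfolding is_coboundary_def
    by (intro exI[of _ "\<lambda>x. inverse (u x)"]) (simp add: divide_inverse mult_ac)
qed

lemma cohomologous_refl: "cocycle G f \<Longrightarrow> cohomologous G f f"
  unfolding cohomologous_def is_coboundary_def
  by (intro exI[of _ "\<lambda>_. 1"]) (auto simp: cocycleD)

lemma cohomologous_sym: "cohomologous G f g \<Longrightarrow> cohomologous G g f"
  unfolding cohomologous_def using is_coboundary_inverse[of G "\<lambda>s. f s / g s"] by simp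

lemma cohomologous_trans:
  assumes "cohomologous G f g" "cohomologous G g h" "cocycle G g"
  shows "cohomologous G f h"
  unfolding cohomologous_def
  by (rule is_coboundary_cong[OF _ is_coboundary_mult[OF assms(1,2)[unfolded cohomologous_def]]])
    (simp add: cocycleD(1)[OF assms(3)])

lemma cocycle_mult:
  assumes f: "cocycle G f" and g: "cocycle G g"
  shows "cocycle G (\<lambda>s. f s * g s)"
  unfolding cocycle_def
proof (intro conjI ballI)
  fix x y z assume c: "x \<in> carrier G" "y \<in> carrier G" "z \<in> carrier G"
  have "(f (x, y) * f (x \<otimes>\<^bsub>G\<^esub> y, z)) * (g (x, y) * g (x \<otimes>\<^bsub>G\<^esub> y, z)) =
      (f (y, z) * f (x, y \<otimes>\<^bsub>G\<^esub> z)) * (g (y, z) * g (x, y \<otimes>\<^bsub>G\<^esub> z))"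
    using cocycleD(2)[OF f c] cocycleD(2)[OF g c] by simp
  then show "f (x, y) * g (x, y) * (f (x \<otimes>\<^bsub>G\<^esub> y, z) * g (x \<otimes>\<^bsub>G\<^esub> y, z)) =
      f (y, z) * g (y, z) * (f (x, y \<otimes>\<^bsub>G\<^esub> z) * g (x, y \<otimes>\<^bsub>G\<^esub> z))"
    by (simp only: mult_ac)
qed (simp add: cocycleD(1)[OF f] cocycleD(1)[OF g])

lemma cocycle_inverse: "cocycle G f \<Longrightarrow> cocycle G (\<lambda>s. inverse (f s))"
  by (auto simp: cocycle_def simp flip: inverse_mult_distrib)

lemma cocycle_divide: "cocycle G f \<Longrightarrow> cocycle G g \<Longrightarrow> cocycle G (\<lambda>s. f s / g s)"
  unfolding divide_inverse by (intro cocycle_mult cocycle_inverse)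

lemma (in group) cocycle_coboundary:
  assumes "\<And>x. x \<in> carrier G \<Longrightarrow> u x \<noteq> 0"
  shows "cocycle G (\<lambda>(x, y). u x * u y / u (x \<otimes> y))"
  using assms by (auto simp: cocycle_def m_assoc)

lemma cocycle_restrict:
  assumes "group G" "cocycle G f" shows "restrict f (carrier G \<times> carrier G) \<in> cocycles2 G"
proof -
  interpret group G by fact
  show ?thesis using assms(2) by (auto simp: cocycles2_def cocycle_def)
qed

lemma (in group) cohomologous_iff_coset:
  assumes f: "f \<in> cocycles2 G" and g: "g \<in> cocycles2 G"
  shows "cohomologous G f g \<longleftrightarrow> f \<in> coboundaries2 G #>\<^bsub>cocycle_group2 G\<^esub> g"
proof
  note nz = cocycleD(1)[OF cocycles2_cocycle[OF g]]
  assume "cohomologous G f g"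
  then obtain u where u: "\<And>x. x \<in> carrier G \<Longrightarrow> u x \<noteq> 0"
    "\<And>x y. x \<in> carrier G \<Longrightarrow> y \<in> carrier G \<Longrightarrow> f (x, y) / g (x, y) = u x * u y / u (x \<otimes> y)"
    unfolding cohomologous_def is_coboundary_def by metis
  have "f = coboundary2 G u \<otimes>\<^bsub>cocycle_group2 G\<^esub> g"
  proof
    fix s show "f s = (coboundary2 G u \<otimes>\<^bsub>cocycle_group2 G\<^esub> g) s"
    proof (cases "s \<in> carrier G \<times> carrier G")
      case True
      then obtain x y where s: "s = (x, y)" "x \<in> carrier G" "y \<in> carrier G" by auto
      have "f (x, y) = (u x * u y / u (x \<otimes> y)) * g (x, y)"
        using u(2)[OF s(2,3)] nz[OF s(2,3)] by (simp add: divide_eq_eq)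
      then show ?thesis using s by (simp add: cocycle_group2_def coboundary2_def)
    next
      case False
      then have "f s = undefined" using f by (auto simp: cocycles2_def)
      then show ?thesis using False by (simp add: cocycle_group2_def)
    qed
  qed
  then show "f \<in> coboundaries2 G #>\<^bsub>cocycle_group2 G\<^esub> g"
    using coboundaries2I[of G u] u(1) by (auto simp: r_coset_def)
next
  note nz = cocycleD(1)[OF cocycles2_cocycle[OF g]]
  assume "f \<in> coboundaries2 G #>\<^bsub>cocycle_group2 G\<^esub> g"
  then obtain u where u: "\<And>x. x \<in> carrier G \<Longrightarrow> u x \<noteq> 0" "f = coboundary2 G u \<otimes>\<^bsub>cocycle_group2 G\<^esub> g"
    by (auto simp: r_coset_def coboundaries2_def)
  then show "cohomologous G f g" using nz
    unfolding cohomologous_def is_coboundary_def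
    by (intro exI[of _ u]) (auto simp: cocycle_group2_def coboundary2_def)
qed

text \<open>Choosing one cocycle in each class turns the order of the quotient group into the size of a set of
  functions, on which injections can be defined directly.\<close>

lemma (in group) cohomology_transversal:
  assumes "finite (carrier G)"
  obtains R where "finite R" "card R = order (schur_multiplier G)"
    "\<And>r. r \<in> R \<Longrightarrow> cocycle G r"
    "\<And>f. cocycle G f \<Longrightarrow> \<exists>r\<in>R. cohomologous G f r"
    "\<And>r r'. r \<in> R \<Longrightarrow> r' \<in> R \<Longrightarrow> cohomologous G r r' \<Longrightarrow> r = r'"
proof -
  interpret Z: comm_group "cocycle_group2 G" by (rule cocycle_group2_comm_group)
  let ?Z = "cocycle_group2 G" and ?B = "coboundaries2 G"
  have carr: "carrier ?Z = cocycles2 G" by (simp add: cocycle_group2_def)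
  have M: "carrier (schur_multiplier G) = rcosets\<^bsub>?Z\<^esub> ?B"
    by (simp add: schur_multiplier_def FactGroup_def)
  define R where "R = (\<lambda>C. SOME f. f \<in> C) ` (rcosets\<^bsub>?Z\<^esub> ?B)"
  have C: "(SOME f. f \<in> C) \<in> C" "C \<subseteq> cocycles2 G"
     "\<And>f. f \<in> C \<Longrightarrow> ?B #>\<^bsub>?Z\<^esub> f = C" if C: "C \<in> rcosets\<^bsub>?Z\<^esub> ?B" for C
  proof -
    obtain f where f: "f \<in> cocycles2 G" "C = ?B #>\<^bsub>?Z\<^esub> f"
      using C by (auto simp: RCOSETS_def carr)
    have "f \<in> C" using Z.rcos_self[OF _ coboundaries2_subgroup] f carr by simp
    then show "(SOME f. f \<in> C) \<in> C" by (rule someI[of "\<lambda>f. f \<in> C"])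
    show "C \<subseteq> cocycles2 G" using Z.rcosets_part_G[OF coboundaries2_subgroup] C carr by blast
    show "?B #>\<^bsub>?Z\<^esub> g = C" if "g \<in> C" for g
      using Z.repr_independence[OF _ _ coboundaries2_subgroup] that f carr by blast
  qed
  have inj: "C = C'" if CC: "C \<in> rcosets\<^bsub>?Z\<^esub> ?B" "C' \<in> rcosets\<^bsub>?Z\<^esub> ?B"
    "cohomologous G (SOME f. f \<in> C) (SOME f. f \<in> C')" for C C'
  proof -
    have m: "(SOME f. f \<in> C) \<in> C" "(SOME f. f \<in> C') \<in> C'" using CC(1,2) C(1) by blast+
    then have "(SOME f. f \<in> C) \<in> cocycles2 G" "(SOME f. f \<in> C') \<in> cocycles2 G"
      using CC(1,2) C(2) by blast+
    then have "(SOME f. f \<in> C) \<in> ?B #>\<^bsub>?Z\<^esub> (SOME f. f \<in> C')"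
      using CC(3) cohomologous_iff_coset by blast
    then have "(SOME f. f \<in> C) \<in> C'" using C(3)[OF CC(2) m(2)] by simp
    then show ?thesis using C(3)[OF CC(1) m(1)] C(3)[OF CC(2)] by simp
  qed
  show thesis
  proof
    show "finite R" using finite_schur_multiplier[OF assms] by (simp add: R_def M)
    have "inj_on (\<lambda>C. SOME f. f \<in> C) (rcosets\<^bsub>?Z\<^esub> ?B)"
    proof (rule inj_onI)
      fix C C' assume CC: "C \<in> rcosets\<^bsub>?Z\<^esub> ?B" "C' \<in> rcosets\<^bsub>?Z\<^esub> ?B"
        "(SOME f. f \<in> C) = (SOME f. f \<in> C')"
      have "cocycle G (SOME f. f \<in> C)"
        using C(1,2)[OF CC(1)] by (intro cocycles2_cocycle) blast
      from cohomologous_refl[OF this] have "cohomologous G (SOME f. f \<in> C) (SOME f. f \<in> C')"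
        using CC(3) by simp
      then show "C = C'" by (rule inj[OF CC(1,2)])
    qed
    then show "card R = order (schur_multiplier G)"
      by (simp add: R_def order_def M card_image)
    show "cocycle G r" if "r \<in> R" for r
    proof -
      obtain C where r: "C \<in> rcosets\<^bsub>?Z\<^esub> ?B" "r = (SOME f. f \<in> C)" using \<open>r \<in> R\<close> by (auto simp: R_def)
      show ?thesis unfolding r(2) using C(1,2)[OF r(1)] by (intro cocycles2_cocycle) blast
    qed
    show "r = r'" if "r \<in> R" "r' \<in> R" "cohomologous G r r'" for r r'
      using that inj unfolding R_def by blast
    fix f assume f: "cocycle G f"
    let ?f = "restrict f (carrier G \<times> carrier G)"
    have f': "?f \<in> cocycles2 G" using cocycle_restrict[OF is_group f] .
    let ?C = "?B #>\<^bsub>?Z\<^esub> ?f"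
    have c: "?C \<in> rcosets\<^bsub>?Z\<^esub> ?B" using f' by (auto simp: RCOSETS_def carr)
    have "(SOME h. h \<in> ?C) \<in> cocycles2 G" using C(1,2)[OF c] by blast
    then have "cohomologous G (SOME h. h \<in> ?C) ?f"
      using C(1)[OF c] cohomologous_iff_coset[OF _ f'] by blast
    then have "cohomologous G ?f (SOME h. h \<in> ?C)" by (rule cohomologous_sym)
    then have "cohomologous G f (SOME h. h \<in> ?C)"
      unfolding cohomologous_def by (rule is_coboundary_cong[rotated]) auto
    then show "\<exists>r\<in>R. cohomologous G f r" using c unfolding R_def by blast
  qed
qed

section \<open>The quotient by a central subgroup of prime order\<close>

locale central_prime = group G for G :: "('a, 'b) monoid_scheme" (structure) +
  fixes p :: nat and z :: 'a
  assumes prime: "prime p" and central_z: "central z" and z_ne: "z \<noteq> \<one>" and z_pow: "z [^] p = \<one>"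
begin

definition K :: "'a set" where "K = range (\<lambda>i::nat. z [^] i)"

lemma z_closed [simp]: "z \<in> carrier G" using central_z by (rule centralD)

lemma p_gt_1: "p > 1" using prime by (rule prime_gt_1_nat)

lemma ord_z: "ord z = p"
proof -
  have "ord z dvd p" using z_pow pow_eq_id by simp
  moreover have "ord z \<noteq> 1" using z_ne ord_eq_1 by simp
  ultimately show ?thesis using prime by (metis prime_nat_iff)
qed

lemma z_pow_eq_iff: "z [^] i = z [^] j \<longleftrightarrow> i mod p = j mod p"
proof -
  have *: "z [^] i = z [^] (i mod p)" for i :: nat
    using ord_z pow_ord_eq_1[of z]
    by (metis mult_div_mod_eq nat_pow_mult nat_pow_one nat_pow_pow z_closed l_one nat_pow_closed)
  have "inj_on (\<lambda>i. z [^] i) {0..p - 1}"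
    using ord_inj[of z] ord_z by simp
  then have "z [^] (i mod p) = z [^] (j mod p) \<longleftrightarrow> i mod p = j mod p"
    using p_gt_1 by (auto simp: inj_on_def less_Suc_eq_le[symmetric])
  then show ?thesis using * by metis
qed

lemma K_pow: "z [^] (i::nat) \<in> K" by (simp add: K_def)

lemma z_in_K: "z \<in> K" using z_closed unfolding K_def by (metis nat_pow_eone rangeI)

lemma K_closed: "k \<in> K \<Longrightarrow> k \<in> carrier G" by (auto simp: K_def)

lemma one_in_K: "\<one> \<in> K" using K_pow[of 0] by simp

lemma K_mult: "k \<in> K \<Longrightarrow> l \<in> K \<Longrightarrow> k \<otimes> l \<in> K"
  by (auto simp: K_def nat_pow_mult)

lemma K_inv: assumes "k \<in> K" shows "inv k \<in> K"
proof -
  obtain i :: nat where i: "k = z [^] i" using assms by (auto simp: K_def)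
  have "z [^] ((p - 1) * i) \<otimes> z [^] i = z [^] (p * i)"
    using p_gt_1 by (simp add: nat_pow_mult algebra_simps)
  also have "\<dots> = z [^] (0::nat)" by (subst z_pow_eq_iff) simp
  finally have "inv k = z [^] ((p - 1) * i)" using i by (intro inv_equality) auto
  then show ?thesis by (simp add: K_pow)
qed

lemma subgroup_K: "subgroup K G"
  using K_closed K_mult K_inv one_in_K by (auto intro!: subgroup.intro)

lemma central_pow: "central (z [^] (i::nat))"
  by (induction i) (simp_all add: central_z)

lemma K_central: "k \<in> K \<Longrightarrow> central k"
  using central_pow by (auto simp: K_def)

lemma K_comm: "k \<in> K \<Longrightarrow> g \<in> carrier G \<Longrightarrow> k \<otimes> g = g \<otimes> k"
  using K_central centralD by blast

lemma card_K: "card K = p"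
proof -
  have "K = (\<lambda>i. z [^] i) ` {..<p}"
  proof
    show "K \<subseteq> (\<lambda>i. z [^] i) ` {..<p}"
    proof
      fix k assume "k \<in> K"
      then obtain i :: nat where "k = z [^] i" by (auto simp: K_def)
      then have "k = z [^] (i mod p)" using z_pow_eq_iff by simp
      then show "k \<in> (\<lambda>i. z [^] i) ` {..<p}" using p_gt_1 by auto
    qed
  qed (auto simp: K_def)
  moreover have "inj_on (\<lambda>i::nat. z [^] i) {..<p}" by (auto simp: inj_on_def z_pow_eq_iff)
  ultimately show ?thesis by (simp add: card_image)
qed

lemma finite_K: "finite K" using card_K p_gt_1 by (metis card.infinite not_less0)

lemma K_subset_subgroup: "subgroup S G \<Longrightarrow> z \<in> S \<Longrightarrow> K \<subseteq> S"
proof -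
  assume S: "subgroup S G" "z \<in> S"
  have "z [^] (i::nat) \<in> S" for i
    by (induction i) (simp_all add: S subgroup.m_closed subgroup.one_closed)
  then show "K \<subseteq> S" by (auto simp: K_def)
qed

definition dlog :: "'a \<Rightarrow> nat" where "dlog k = (SOME i. k = z [^] i)"

lemma pow_dlog: "k \<in> K \<Longrightarrow> z [^] dlog k = k"
proof -
  assume "k \<in> K"
  then have "\<exists>i. k = z [^] (i::nat)" by (auto simp: K_def)
  from someI_ex[OF this] show "z [^] dlog k = k" by (simp add: dlog_def)
qed

text \<open>The choice depends only on the coset $g K$, because the predicate does.\<close>

definition rep :: "'a \<Rightarrow> 'a" where "rep g = (SOME h. h \<in> carrier G \<and> inv g \<otimes> h \<in> K)"

lemma rep:
  assumes "g \<in> carrier G" shows rep_closed: "rep g \<in> carrier G" and inv_rep: "inv g \<otimes> rep g \<in> K"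
proof -
  have "\<exists>h. h \<in> carrier G \<and> inv g \<otimes> h \<in> K" using assms one_in_K by (intro exI[of _ g]) simp
  from someI_ex[OF this] show "rep g \<in> carrier G" "inv g \<otimes> rep g \<in> K" by (simp_all add: rep_def)
qed

lemma rep_mult_K: assumes "g \<in> carrier G" "k \<in> K" shows "rep (g \<otimes> k) = rep g"
proof -
  have "inv (g \<otimes> k) \<otimes> h \<in> K \<longleftrightarrow> inv g \<otimes> h \<in> K" if "h \<in> carrier G" for h
  proof -
    have "inv (g \<otimes> k) \<otimes> h = inv k \<otimes> (inv g \<otimes> h)"
      using assms that K_closed by (simp add: inv_mult_group m_assoc)
    moreover have "k \<otimes> (inv k \<otimes> (inv g \<otimes> h)) = inv g \<otimes> h"
      using assms that K_closed by (simp add: mult_inv_cancel)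
    ultimately show ?thesis using K_mult K_inv assms by metis
  qed
  then show ?thesis by (simp add: rep_def cong: conj_cong)
qed

lemma rep_eq_iff: assumes "g \<in> carrier G" "h \<in> carrier G" shows "rep g = rep h \<longleftrightarrow> inv g \<otimes> h \<in> K"
proof
  assume e: "rep g = rep h"
  have "inv g \<otimes> h = (inv g \<otimes> rep g) \<otimes> inv (inv h \<otimes> rep h)"
    using assms rep_closed by (simp add: e inv_mult_group m_assoc mult_inv_cancel)
  then show "inv g \<otimes> h \<in> K" using inv_rep assms K_mult K_inv by simp
next
  assume "inv g \<otimes> h \<in> K"
  then show "rep g = rep h" using rep_mult_K[of g "inv g \<otimes> h"] assms by (simp add: mult_inv_cancel)
qed

lemma rep_rep: "g \<in> carrier G \<Longrightarrow> rep (rep g) = rep g"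
  using rep_eq_iff[of g "rep g"] rep_closed inv_rep by simp

definition residue :: "'a \<Rightarrow> 'a" where "residue g = inv (rep g) \<otimes> g"

lemma residue_in_K: assumes "g \<in> carrier G" shows "residue g \<in> K"
proof -
  have "residue g = inv (inv g \<otimes> rep g)"
    using assms rep_closed by (simp add: residue_def inv_mult_group)
  then show ?thesis using inv_rep K_inv assms by simp
qed

lemma residue_closed: "g \<in> carrier G \<Longrightarrow> residue g \<in> carrier G"
  using residue_in_K K_closed by blast

lemma rep_mult_residue: "g \<in> carrier G \<Longrightarrow> rep g \<otimes> residue g = g"
  by (simp add: residue_def rep_closed mult_inv_cancel)

lemma residue_mult_K: "g \<in> carrier G \<Longrightarrow> k \<in> K \<Longrightarrow> residue (g \<otimes> k) = residue g \<otimes> k"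
  using K_closed rep_closed by (simp add: residue_def rep_mult_K m_assoc)

lemma mult_split:
  assumes "g \<in> carrier G" "h \<in> carrier G"
  shows "g \<otimes> h = (rep g \<otimes> rep h) \<otimes> (residue g \<otimes> residue h)"
proof -
  have "g \<otimes> h = (rep g \<otimes> residue g) \<otimes> (rep h \<otimes> residue h)"
    using assms by (simp add: rep_mult_residue)
  also have "\<dots> = rep g \<otimes> ((residue g \<otimes> rep h) \<otimes> residue h)"
    using assms by (simp add: m_assoc rep_closed residue_closed)
  also have "residue g \<otimes> rep h = rep h \<otimes> residue g"
    using assms K_comm rep_closed residue_in_K by blast
  finally show ?thesis using assms by (simp add: m_assoc rep_closed residue_closed)
qed

lemma rep_mult: "g \<in> carrier G \<Longrightarrow> h \<in> carrier G \<Longrightarrow> rep (rep g \<otimes> rep h) = rep (g \<otimes> h)"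
  using mult_split[of g h] rep_mult_K[of "rep g \<otimes> rep h" "residue g \<otimes> residue h"]
  by (simp add: rep_closed residue_in_K K_mult)

text \<open>The correction term \<open>residue (rep g \<otimes> rep h)\<close> is the cocycle of the extension of $G/K$ by $K$.\<close>

lemma residue_mult:
  "g \<in> carrier G \<Longrightarrow> h \<in> carrier G \<Longrightarrow>
   residue (g \<otimes> h) = residue (rep g \<otimes> rep h) \<otimes> residue g \<otimes> residue h"
  using mult_split[of g h] residue_mult_K[of "rep g \<otimes> rep h" "residue g \<otimes> residue h"]
  by (simp add: rep_closed residue_in_K residue_closed K_mult m_assoc)

text \<open>The quotient $G / K$ realised on coset representatives. Its elements have the same type as those of
  $G$, which is what makes inductions along quotients possible.\<close>

definition Q :: "'a monoid" where
  "Q = \<lparr>carrier = rep ` carrier G, mult = (\<lambda>x y. rep (x \<otimes> y)), one = rep \<one>\<rparr>"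

lemma Q_simps: "carrier Q = rep ` carrier G" "x \<otimes>\<^bsub>Q\<^esub> y = rep (x \<otimes> y)" "\<one>\<^bsub>Q\<^esub> = rep \<one>"
  by (simp_all add: Q_def)

lemma QD: assumes "x \<in> carrier Q" shows "x \<in> carrier G" "rep x = x" "residue x = \<one>"
  using assms rep_closed rep_rep by (auto simp: Q_simps residue_def)

lemma Q_closed: "g \<in> carrier G \<Longrightarrow> rep g \<in> carrier Q" by (simp add: Q_simps)

lemma rep_absorb:
  assumes "g \<in> carrier G" "h \<in> carrier G"
  shows "rep (rep g \<otimes> h) = rep (g \<otimes> h)" "rep (g \<otimes> rep h) = rep (g \<otimes> h)"
  using rep_mult[OF assms] rep_mult[of "rep g" h] rep_mult[of g "rep h"] assms
  by (simp_all add: rep_closed rep_rep)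

lemma group_Q: "group Q"
proof (rule groupI)
  fix x assume x: "x \<in> carrier Q"
  have "rep (inv x) \<in> carrier Q" using QD[OF x] Q_closed by simp
  moreover have "rep (inv x) \<otimes>\<^bsub>Q\<^esub> x = \<one>\<^bsub>Q\<^esub>"
    using QD[OF x] rep_absorb[of "inv x" x] by (simp add: Q_simps)
  ultimately show "\<exists>y\<in>carrier Q. y \<otimes>\<^bsub>Q\<^esub> x = \<one>\<^bsub>Q\<^esub>" by blast
next
  fix x y w assume "x \<in> carrier Q" "y \<in> carrier Q" "w \<in> carrier Q"
  then have c: "x \<in> carrier G" "y \<in> carrier G" "w \<in> carrier G" by (simp_all only: QD(1))
  show "x \<otimes>\<^bsub>Q\<^esub> y \<otimes>\<^bsub>Q\<^esub> w = x \<otimes>\<^bsub>Q\<^esub> (y \<otimes>\<^bsub>Q\<^esub> w)"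
    using c by (simp add: Q_simps(2) rep_absorb m_assoc)
  show "x \<otimes>\<^bsub>Q\<^esub> y \<in> carrier Q" using c by (simp add: Q_simps(2) Q_closed)
next
  show "\<one>\<^bsub>Q\<^esub> \<in> carrier Q" by (simp add: Q_simps(3) Q_closed)
next
  fix x assume x: "x \<in> carrier Q"
  show "\<one>\<^bsub>Q\<^esub> \<otimes>\<^bsub>Q\<^esub> x = x"
    using rep_absorb(1)[of \<one> x] QD[OF x] by (simp add: Q_simps(2,3))
qed

lemma rep_hom: "group_hom G Q rep"
proof -
  have "rep \<in> hom G Q" by (auto simp: hom_def Q_closed) (simp add: Q_simps rep_mult)
  then show ?thesis using group_Q by (simp add: group_hom.intro group_hom_axioms.intro)
qed

lemma rep_surj: "rep ` carrier G = carrier Q" by (simp add: Q_simps)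

lemma rep_eq_one_iff: "g \<in> carrier G \<Longrightarrow> rep g = \<one>\<^bsub>Q\<^esub> \<longleftrightarrow> g \<in> K"
  using rep_eq_iff[of \<one> g] by (simp add: Q_simps(3) eq_commute[of "rep g"])

lemma card_image_rep:
  assumes S: "subgroup S G" "K \<subseteq> S"
  shows "card S = card (rep ` S) * p"
proof -
  have S': "rep g \<in> S" if "g \<in> S" for g
  proof -
    have "inv g \<otimes> rep g \<in> S" using inv_rep that S subgroup.subset by blast
    then have "g \<otimes> (inv g \<otimes> rep g) \<in> S" using that S subgroup.m_closed by metis
    then show ?thesis using that S(1) subgroup.subset rep_closed mult_inv_cancel by (metis subsetD)
  qed
  have c: "g \<in> carrier G" if "g \<in> S" for g using that S subgroup.subset by blast
  have "bij_betw (\<lambda>(x, k). x \<otimes> k) (rep ` S \<times> K) S"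
  proof (rule bij_betw_byWitness[where f' = "\<lambda>g. (rep g, residue g)"])
    show "\<forall>s\<in>rep ` S \<times> K. (\<lambda>g. (rep g, residue g)) ((\<lambda>(x, k). x \<otimes> k) s) = s"
      using c rep_mult_K residue_mult_K rep_closed rep_rep QD(3) Q_closed K_closed by auto
    show "\<forall>g\<in>S. (\<lambda>(x, k). x \<otimes> k) (rep g, residue g) = g"
      using c rep_mult_residue by auto
    show "(\<lambda>(x, k). x \<otimes> k) ` (rep ` S \<times> K) \<subseteq> S"
      using S S' subgroup.m_closed by fastforce
    show "(\<lambda>g. (rep g, residue g)) ` S \<subseteq> rep ` S \<times> K"
      using c residue_in_K by auto
  qed
  then show ?thesis using bij_betw_same_card card_K by (metis card_cartesian_product)
qed

lemma order_Q: "order G = order Q * p"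
proof -
  have "K \<subseteq> carrier G" using K_closed by blast
  from card_image_rep[OF subgroup_self this] show ?thesis by (simp only: order_def rep_surj)
qed

lemma finite_Q: "finite (carrier G) \<Longrightarrow> finite (carrier Q)" by (simp add: Q_simps)

end

section \<open>Inflation and transgression\<close>

lemma exists_complex_root:
  assumes "n > 0" "c \<noteq> 0" obtains w :: complex where "w ^ n = c" "w \<noteq> 0"
proof -
  have "card {w. w ^ n = c} = n" using assms by (intro card_nth_roots) auto
  with assms have "{w. w ^ n = c} \<noteq> {}" by (metis card.empty less_irrefl)
  then obtain w where "w ^ n = c" by blast
  moreover from this have "w \<noteq> 0" using assms by (auto simp: power_0_left)
  ultimately show thesis using that by blast
qed

lemma power_mod_root_of_unity: "w ^ n = (1::complex) \<Longrightarrow> w ^ (i mod n) = w ^ i"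
  by (metis mod_mult_div_eq power_add power_mult power_one mult.right_neutral)

context central_prime
begin

text \<open>The multiplier of a cyclic group is trivial: in the extension, a lift of $z$ has a power in
  $\mathbb{C}^\times$, and rescaling it by a root makes its $p$-th power trivial. The powers of this lift are $(w_i, z^i)$,
  and \<open>v\<close> collects the factors $w_i$.\<close>

lemma cocycle_trivial_on_K:
  assumes f: "cocycle G f"
  obtains v where "\<And>k. k \<in> K \<Longrightarrow> v k \<noteq> 0"
    "\<And>k l. k \<in> K \<Longrightarrow> l \<in> K \<Longrightarrow> v (k \<otimes> l) = v k * v l * f (k, l)"
proof -
  note nz = cocycleD(1)[OF f]
  define P where "P i = (\<Prod>j<i. f (z [^] j, z)) / f (\<one>, \<one>)" for i :: nat
  have P0: "P i \<noteq> 0" for i by (simp add: P_def nz)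
  obtain a where a: "a ^ p = P 0 / P p" "a \<noteq> 0"
    using exists_complex_root[of p "P 0 / P p"] P0 p_gt_1 by auto
  define w where "w i = a ^ i * P i" for i
  have w0: "w i \<noteq> 0" for i by (simp add: w_def P0 a)
  have wS: "w (Suc i) = w i * a * f (z [^] i, z)" for i
    by (simp add: w_def P_def)
  have add: "w (i + j) = w i * w j * f (z [^] i, z [^] j)" for i j
  proof (induction j)
    case 0
    then show ?case using cocycle_one(2)[OF f, of "z [^] i"] nz by (simp add: w_def P_def)
  next
    case (Suc j)
    have c: "f (z [^] i, z [^] j) * f (z [^] (i + j), z) = f (z [^] j, z) * f (z [^] i, z [^] Suc j)"
      using cocycleD(2)[OF f, of "z [^] i" "z [^] j" z] by (simp add: nat_pow_mult)
    have "w (i + Suc j) = w i * w j * a * (f (z [^] i, z [^] j) * f (z [^] (i + j), z))"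
      using wS[of "i + j"] Suc by simp
    also have "\<dots> = w i * w (Suc j) * f (z [^] i, z [^] Suc j)"
      unfolding c wS by simp
    finally show ?case .
  qed
  have "w p = w 0" using a P0 by (simp add: w_def)
  then have per1: "w (i + p) = w i" for i
    using add[of i p] add[of i 0] by (simp add: z_pow)
  have "w (i + p * m) = w i" for i m
  proof (induction m)
    case (Suc m)
    then show ?case using per1[of "i + p * m"] by (simp add: add_ac)
  qed simp
  then have "w (i mod p) = w i" for i by (metis mod_mult_div_eq)
  then have per: "w i = w j" if "z [^] i = z [^] j" for i j
    using that z_pow_eq_iff by metis
  have dlog_mult: "w (dlog (k \<otimes> l)) = w (dlog k + dlog l)" if "k \<in> K" "l \<in> K" for k l
    using that by (intro per) (simp add: pow_dlog K_mult flip: nat_pow_mult)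
  show thesis
  proof (rule that[of "\<lambda>k. w (dlog k)"])
    show "w (dlog (k \<otimes> l)) = w (dlog k) * w (dlog l) * f (k, l)" if "k \<in> K" "l \<in> K" for k l
      using that by (simp add: dlog_mult add pow_dlog)
  qed (rule w0)
qed

lemma pairing_K_eq_one:
  assumes f: "cocycle G f" and one: "pairing f z g = 1" and g: "g \<in> carrier G" and k: "k \<in> K"
  shows "f (k, g) = f (g, k)"
proof -
  obtain i :: nat where "k = z [^] i" using k by (auto simp: K_def)
  then have "pairing f k g = 1"
    using pairing_pow_left[OF f g z_closed] one K_comm[OF z_in_K g] by simp
  then show ?thesis using cocycleD(1)[OF f g K_closed[OF k]] by (simp add: pairing_def)
qed

text \<open>If lifts of $z$ are central in the extension, then so is the lift $\{(v(k), k)\}$ of $K$, and the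
  extension comes from $G/K$. In terms of cocycles: lifting $g = r k$ to the product of the lift
  $(1, r)$ of its representative and of $(v(k), k)$ changes $f$ to a cocycle that is constant on
  cosets of $K$.\<close>

lemma cohomologous_to_inflation:
  assumes f: "cocycle G f" and one: "\<And>g. g \<in> carrier G \<Longrightarrow> pairing f z g = 1"
  obtains q where "cocycle Q q" "cohomologous G f (\<lambda>(g, h). q (rep g, rep h))"
proof -
  note nz = cocycleD(1)[OF f]
  note sym = pairing_K_eq_one[OF f one]
  obtain v where v: "\<And>k. k \<in> K \<Longrightarrow> v k \<noteq> 0"
    "\<And>k l. k \<in> K \<Longrightarrow> l \<in> K \<Longrightarrow> v (k \<otimes> l) = v k * v l * f (k, l)"
    using cocycle_trivial_on_K[OF f] by metis
  define u where "u g = f (rep g, residue g) * v (residue g)" for g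
  have u0: "u g \<noteq> 0" if "g \<in> carrier G" for g
    using that by (simp add: u_def nz v residue_in_K residue_closed rep_closed)
  have uK: "u (g \<otimes> k) = u g * v k * f (g, k)" if g: "g \<in> carrier G" and k: "k \<in> K" for g k
  proof -
    have "f (rep g, residue g) * f (g, k) = f (residue g, k) * f (rep g, residue g \<otimes> k)"
      using cocycleD(2)[OF f, of "rep g" "residue g" k] g k
      by (simp add: rep_closed residue_closed K_closed rep_mult_residue)
    then show ?thesis
      using g k by (simp add: u_def rep_mult_K residue_mult_K v(2) residue_in_K)
  qed
  define F where "F = (\<lambda>(x, y). f (x, y) * (u x * u y / u (x \<otimes> y)))"
  have F: "cocycle G F"
    using cocycle_mult[OF f cocycle_coboundary[of u, OF u0]] by (simp add: F_def case_prod_unfold)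
  have F_left: "F (g \<otimes> k, h) = F (g, h)" if c: "g \<in> carrier G" "h \<in> carrier G" and k: "k \<in> K" for g h k
  proof -
    have kc: "k \<in> carrier G" using k K_closed by simp
    have e: "g \<otimes> k \<otimes> h = g \<otimes> h \<otimes> k" using c k kc K_comm[OF k c(2)] by (simp add: m_assoc)
    have "f (g, k) * f (g \<otimes> k, h) = f (k, h) * f (g, k \<otimes> h)"
      using cocycleD(2)[OF f] c kc by blast
    also have "\<dots> = f (h, k) * f (g, h \<otimes> k)" using sym c k K_comm by simp
    also have "\<dots> = f (g, h) * f (g \<otimes> h, k)" using cocycleD(2)[OF f] c kc by metis
    finally have *: "f (g, k) * f (g \<otimes> k, h) = f (g, h) * f (g \<otimes> h, k)" .
    have "F (g \<otimes> k, h) = (f (g, k) * f (g \<otimes> k, h)) * (u g * v k * u h) / (u (g \<otimes> h) * v k * f (g \<otimes> h, k))"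
      using c k by (simp add: F_def e uK)
    then show ?thesis using c kc k nz[of "g \<otimes> h" k] v(1)[OF k] unfolding * by (simp add: F_def)
  qed
  have F_right: "F (g, h \<otimes> k) = F (g, h)" if c: "g \<in> carrier G" "h \<in> carrier G" and k: "k \<in> K" for g h k
  proof -
    have kc: "k \<in> carrier G" using k K_closed by simp
    have e: "g \<otimes> (h \<otimes> k) = g \<otimes> h \<otimes> k" using c kc by (simp add: m_assoc)
    have *: "f (h, k) * f (g, h \<otimes> k) = f (g, h) * f (g \<otimes> h, k)" using cocycleD(2)[OF f] c kc by metis
    have "F (g, h \<otimes> k) = (f (h, k) * f (g, h \<otimes> k)) * (u g * u h * v k) / (u (g \<otimes> h) * v k * f (g \<otimes> h, k))"
      using c k by (simp add: F_def e uK)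
    then show ?thesis using c kc k nz[of "g \<otimes> h" k] v(1)[OF k] unfolding * by (simp add: F_def)
  qed
  have F_rep: "F (rep g, rep h) = F (g, h)" if "g \<in> carrier G" "h \<in> carrier G" for g h
    using F_left[of "rep g" h "residue g"] F_right[of "rep g" "rep h" "residue h"] that
    by (simp add: rep_closed residue_in_K rep_mult_residue)
  have "cocycle Q F" unfolding cocycle_def
  proof (intro conjI ballI)
    fix x y w assume "x \<in> carrier Q" "y \<in> carrier Q" "w \<in> carrier Q"
    note c = QD(1)[OF this(1)] QD(1)[OF this(2)] QD(1)[OF this(3)]
       and r = QD(2)[OF this(1)] QD(2)[OF this(2)] QD(2)[OF this(3)]
    have "F (rep (x \<otimes> y), w) = F (x \<otimes> y, w)" "F (x, rep (y \<otimes> w)) = F (x, y \<otimes> w)"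
      using F_rep[of "x \<otimes> y" w] F_rep[of x "y \<otimes> w"] c r by simp_all
    then show "F (x, y) * F (x \<otimes>\<^bsub>Q\<^esub> y, w) = F (y, w) * F (x, y \<otimes>\<^bsub>Q\<^esub> w)"
      using cocycleD(2)[OF F c] by (simp add: Q_simps(2))
  next
    fix x y assume "x \<in> carrier Q" "y \<in> carrier Q"
    then show "F (x, y) \<noteq> 0" using cocycleD(1)[OF F] QD(1) by blast
  qed
  moreover have "cohomologous G f (\<lambda>(g, h). F (rep g, rep h))"
    unfolding cohomologous_def is_coboundary_def
  proof (intro exI[of _ "\<lambda>x. inverse (u x)"] conjI ballI)
    fix x y assume c: "x \<in> carrier G" "y \<in> carrier G"
    show "f (x, y) / (case (x, y) of (g, h) \<Rightarrow> F (rep g, rep h)) =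
          inverse (u x) * inverse (u y) / inverse (u (x \<otimes> y))"
      unfolding prod.case F_rep[OF c] using nz[OF c] u0 c by (simp add: F_def divide_inverse mult_ac)
  qed (simp add: u0)
  ultimately show thesis using that by blast
qed

definition K_character :: "('a \<Rightarrow> complex) \<Rightarrow> bool" where
  "K_character \<eta> \<longleftrightarrow> (\<forall>k\<in>K. \<eta> k \<noteq> 0) \<and> (\<forall>k\<in>K. \<forall>l\<in>K. \<eta> (k \<otimes> l) = \<eta> k * \<eta> l)"

definition transgression :: "('a \<Rightarrow> complex) \<Rightarrow> 'a \<times> 'a \<Rightarrow> complex" where
  "transgression \<eta> = (\<lambda>(x, y). \<eta> (residue (x \<otimes> y)))"

lemma cocycle_transgression:
  assumes "K_character \<eta>" shows "cocycle Q (transgression \<eta>)"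
  unfolding cocycle_def
proof (intro conjI ballI)
  have mult: "\<And>k l. k \<in> K \<Longrightarrow> l \<in> K \<Longrightarrow> \<eta> (k \<otimes> l) = \<eta> k * \<eta> l"
    using assms by (auto simp: K_character_def)
  fix x y w assume "x \<in> carrier Q" "y \<in> carrier Q" "w \<in> carrier Q"
  note c = QD(1)[OF this(1)] QD(1)[OF this(2)] QD(1)[OF this(3)]
     and r = QD(2)[OF this(1)] QD(2)[OF this(2)] QD(2)[OF this(3)]
     and r1 = QD(3)[OF this(1)] QD(3)[OF this(2)] QD(3)[OF this(3)]
  have "\<eta> (residue (x \<otimes> y \<otimes> w)) = \<eta> (residue (rep (x \<otimes> y) \<otimes> w)) * \<eta> (residue (x \<otimes> y))"
    using residue_mult[of "x \<otimes> y" w] c r r1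
    by (simp add: mult residue_in_K residue_closed rep_closed)
  moreover have "\<eta> (residue (x \<otimes> (y \<otimes> w))) = \<eta> (residue (x \<otimes> rep (y \<otimes> w))) * \<eta> (residue (y \<otimes> w))"
    using residue_mult[of x "y \<otimes> w"] c r r1
    by (simp add: mult residue_in_K residue_closed rep_closed)
  ultimately show "transgression \<eta> (x, y) * transgression \<eta> (x \<otimes>\<^bsub>Q\<^esub> y, w) =
      transgression \<eta> (y, w) * transgression \<eta> (x, y \<otimes>\<^bsub>Q\<^esub> w)"
    using c by (simp add: transgression_def Q_simps(2) m_assoc mult_ac)
next
  fix x y assume "x \<in> carrier Q" "y \<in> carrier Q"
  then have "residue (x \<otimes> y) \<in> K" by (simp only: residue_in_K QD(1) m_closed)
  then show "transgression \<eta> (x, y) \<noteq> 0" using assms by (simp add: transgression_def K_character_def)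
qed

lemma inflated_transgression:
  assumes \<eta>: "K_character \<eta>" and c: "g \<in> carrier G" "h \<in> carrier G"
  shows "transgression \<eta> (rep g, rep h) = \<eta> (residue (g \<otimes> h)) / (\<eta> (residue g) * \<eta> (residue h))"
  using \<eta> c residue_mult[OF c]
  by (simp add: transgression_def K_character_def residue_in_K rep_closed K_mult)

lemma cohomologous_inflation:
  assumes "cohomologous Q q q'"
  shows "cohomologous G (\<lambda>(g, h). q (rep g, rep h)) (\<lambda>(g, h). q' (rep g, rep h))"
proof -
  obtain u where u: "\<And>x. x \<in> carrier Q \<Longrightarrow> u x \<noteq> 0"
    "\<And>x y. x \<in> carrier Q \<Longrightarrow> y \<in> carrier Q \<Longrightarrow> q (x, y) / q' (x, y) = u x * u y / u (x \<otimes>\<^bsub>Q\<^esub> y)"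
    using assms unfolding cohomologous_def is_coboundary_def by metis
  show ?thesis unfolding cohomologous_def is_coboundary_def
    by (intro exI[of _ "\<lambda>g. u (rep g)"]) (simp add: u Q_closed rep_mult Q_simps(2))
qed

text \<open>The inflation of a transgression is the coboundary of \<open>inverse (\<eta> (residue g))\<close>. So if two transgressions
  are cohomologous on the quotient, two functions on $G$ have the same coboundary, and their quotient
  \<open>\<chi>\<close> is a homomorphism. Its restriction to $K$ is the quotient of the two characters.\<close>

lemma transgression_cohomologous_imp:
  assumes \<eta>: "K_character \<eta>" "K_character \<eta>'"
    and coh: "cohomologous Q (transgression \<eta>) (transgression \<eta>')"
  obtains \<chi> where "\<And>g. g \<in> carrier G \<Longrightarrow> \<chi> g \<noteq> (0::complex)"
    "\<And>g h. g \<in> carrier G \<Longrightarrow> h \<in> carrier G \<Longrightarrow> \<chi> (g \<otimes> h) = \<chi> g * \<chi> h"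
    "\<And>k. k \<in> K \<Longrightarrow> \<chi> k * \<eta>' k = \<eta> k"
proof -
  obtain u where u: "\<And>x. x \<in> carrier Q \<Longrightarrow> u x \<noteq> 0"
    "\<And>x y. x \<in> carrier Q \<Longrightarrow> y \<in> carrier Q \<Longrightarrow>
       transgression \<eta> (x, y) / transgression \<eta>' (x, y) = u x * u y / u (x \<otimes>\<^bsub>Q\<^esub> y)"
    using coh unfolding cohomologous_def is_coboundary_def by metis
  define \<rho> where "\<rho> k = \<eta> k / \<eta>' k" for k
  have \<rho>0: "\<rho> k \<noteq> 0" if "k \<in> K" for k using that \<eta> by (simp add: \<rho>_def K_character_def)
  have \<rho>m: "\<rho> (k \<otimes> l) = \<rho> k * \<rho> l" if "k \<in> K" "l \<in> K" for k l
    using that \<eta> by (simp add: \<rho>_def K_character_def)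
  define \<chi> where "\<chi> g = \<rho> (residue g) * u (rep g)" for g
  have \<chi>0: "\<chi> g \<noteq> 0" if "g \<in> carrier G" for g
    using that by (simp add: \<chi>_def \<rho>0 u residue_in_K Q_closed)
  have \<chi>m: "\<chi> (g \<otimes> h) = \<chi> g * \<chi> h" if c: "g \<in> carrier G" "h \<in> carrier G" for g h
  proof -
    have "transgression \<eta> (rep g, rep h) / transgression \<eta>' (rep g, rep h)
       = \<rho> (residue (g \<otimes> h)) / (\<rho> (residue g) * \<rho> (residue h))"
      using c \<eta> by (simp add: inflated_transgression \<rho>_def)
    then have "\<rho> (residue (g \<otimes> h)) / (\<rho> (residue g) * \<rho> (residue h)) = u (rep g) * u (rep h) / u (rep (g \<otimes> h))"
      using u(2)[of "rep g" "rep h"] c by (simp add: Q_closed Q_simps(2) rep_mult)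
    then show ?thesis
      using c \<rho>0 u(1) by (simp add: \<chi>_def residue_in_K Q_closed frac_eq_eq mult_ac)
  qed
  have \<chi>K: "\<chi> k = \<rho> k" if k: "k \<in> K" for k
  proof -
    have "\<chi> \<one> = 1" using \<chi>m[of \<one> \<one>] \<chi>0[of \<one>] by simp
    moreover have "\<chi> (\<one> \<otimes> k) = \<chi> \<one> * \<rho> k"
      using k rep_mult_K[of \<one> k] residue_mult_K[of \<one> k] residue_in_K[of \<one>]
      by (simp add: \<chi>_def \<rho>m del: l_one)
    ultimately show ?thesis using k K_closed by simp
  qed
  show thesis
    using \<eta>(2) by (intro that[of \<chi>] \<chi>0 \<chi>m) (simp_all add: \<chi>K \<rho>_def K_character_def)
qed

end

section \<open>Characters with values in the roots of unity\<close>

context group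
begin

lemma card_subgroup_dvd:
  assumes "finite (carrier G)" "subgroup S G" "subgroup T G" "S \<subseteq> T"
  shows "card S dvd card T"
proof -
  interpret T: group "G\<lparr>carrier := T\<rparr>" using subgroup_imp_group[OF assms(3)] .
  have "subgroup S (G\<lparr>carrier := T\<rparr>)" using subgroup_incl[OF assms(2-4)] .
  from T.lagrange[OF this] show ?thesis by (auto simp: order_def dvd_def mult.commute dest: sym)
qed

lemma card_subgroup_strict:
  assumes p: "prime p" "order G = p ^ n" and S: "subgroup S G" and T: "subgroup T G" and ST: "S \<subset> T"
  shows "p * card S \<le> card T"
proof -
  have fin: "finite (carrier G)" using p order_gt_0_iff_finite by (simp add: prime_gt_0_nat)
  have "card S dvd card T" using card_subgroup_dvd[OF fin S T] ST by blast
  moreover have "card T dvd p ^ n"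
    using card_subgroup_dvd[OF fin T subgroup_self] subgroup.subset[OF T] p by (simp add: order_def)
  ultimately obtain i j where ij: "card S = p ^ i" "card T = p ^ j"
    using divides_primepow_nat[OF p(1)] by (meson dvd_trans)
  have "card S < card T"
    using ST fin subgroup.subset[OF T] by (intro psubset_card_mono) (auto intro: finite_subset)
  then have "i < j" using ij p prime_gt_1_nat by simp
  then have "p ^ Suc i \<le> p ^ j" using p prime_gt_0_nat by (intro power_increasing) (auto simp: Suc_le_eq)
  then show ?thesis by (simp add: ij)
qed

definition root_characters :: "nat \<Rightarrow> ('a \<Rightarrow> complex) set" where
  "root_characters p = {\<chi> \<in> carrier G \<rightarrow>\<^sub>E {w. w ^ p = 1}.
     \<forall>g\<in>carrier G. \<forall>h\<in>carrier G. \<chi> (g \<otimes> h) = \<chi> g * \<chi> h}"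

lemma root_characterD:
  assumes "\<chi> \<in> root_characters p" "g \<in> carrier G"
  shows "\<chi> g ^ p = 1" "h \<in> carrier G \<Longrightarrow> \<chi> (g \<otimes> h) = \<chi> g * \<chi> h"
  using assms by (auto simp: root_characters_def PiE_def Pi_def)

lemma root_character_nonzero:
  "\<chi> \<in> root_characters p \<Longrightarrow> p > 0 \<Longrightarrow> g \<in> carrier G \<Longrightarrow> \<chi> g \<noteq> 0"
  using root_characterD(1)[of \<chi> p g] by (auto simp: power_0_left)

lemma finite_root_characters: "finite (carrier G) \<Longrightarrow> p > 0 \<Longrightarrow> finite (root_characters p)"
  unfolding root_characters_def
  by (rule finite_subset[OF _ finite_PiE[of "carrier G" "\<lambda>_. {w::complex. w ^ p = 1}"]])
    (auto intro: finite_roots_unity)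

lemma hom_one_on_generate:
  assumes \<chi>: "\<And>g. g \<in> carrier G \<Longrightarrow> \<chi> g \<noteq> (0::complex)"
    "\<And>g h. g \<in> carrier G \<Longrightarrow> h \<in> carrier G \<Longrightarrow> \<chi> (g \<otimes> h) = \<chi> g * \<chi> h"
    and S: "S \<subseteq> carrier G" "\<And>s. s \<in> S \<Longrightarrow> \<chi> s = 1" and x: "x \<in> generate G S"
  shows "\<chi> x = 1"
proof -
  have one: "\<chi> \<one> = 1" using \<chi>(1)[of \<one>] \<chi>(2)[of \<one> \<one>] by simp
  show ?thesis using x
  proof induction
    case (inv h)
    then show ?case using \<chi>(2)[of h "inv h"] S one by auto
  next
    case (eng h1 h2)
    then show ?case using \<chi>(2) generate_in_carrier[OF S(1)] by simp
  qed (use one S in auto)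
qed

lemma hom_one_on_derived:
  assumes \<chi>: "\<And>g. g \<in> carrier G \<Longrightarrow> \<chi> g \<noteq> (0::complex)"
    "\<And>g h. g \<in> carrier G \<Longrightarrow> h \<in> carrier G \<Longrightarrow> \<chi> (g \<otimes> h) = \<chi> g * \<chi> h"
    and x: "x \<in> derived G (carrier G)"
  shows "\<chi> x = 1"
proof (rule hom_one_on_generate[OF \<chi>])
  fix s assume "s \<in> derived_set G (carrier G)"
  then obtain g h where s: "s = g \<otimes> h \<otimes> inv g \<otimes> inv h" and c: "g \<in> carrier G" "h \<in> carrier G" by auto
  have "\<chi> s * \<chi> (h \<otimes> g) = \<chi> (s \<otimes> (h \<otimes> g))" using \<chi>(2) c s by simp
  also have "s \<otimes> (h \<otimes> g) = g \<otimes> h" using c by (simp add: s word_simps)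
  finally show "\<chi> s = 1" using \<chi> c by (simp add: mult.commute)
qed (use x in \<open>auto simp: derived_def\<close>)

lemma root_character_determined_generate:
  assumes \<chi>: "\<chi> \<in> root_characters p" "\<chi>' \<in> root_characters p" "p > 0"
    and S: "S \<subseteq> carrier G" "\<And>s. s \<in> S \<Longrightarrow> \<chi> s = \<chi>' s" and x: "x \<in> generate G S"
  shows "\<chi> x = \<chi>' x"
proof -
  have "(\<lambda>g. \<chi> g / \<chi>' g) x = 1"
    by (rule hom_one_on_generate[OF _ _ S(1) _ x])
      (use \<chi> S root_character_nonzero in \<open>auto simp: root_characterD(2)\<close>)
  then show ?thesis by (simp add: divide_eq_1_iff)
qed

text \<open>Enlarging $S$ by one element outside of it multiplies the number of restrictions to $S$ by at most $p$,
  since one more value has to be chosen, and the order of $S$ by at least $p$. The induction starts from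
  \<open>S = carrier G\<close>, where the restriction map is injective.\<close>

lemma card_root_characters_restriction:
  assumes p: "prime p" and G: "order G = p ^ n" and X: "X \<subseteq> root_characters p" and S: "subgroup S G"
  shows "card X * card S \<le> card ((\<lambda>\<chi>. restrict \<chi> S) ` X) * order G"
  using S
proof (induction "order G - card S" arbitrary: S rule: less_induct)
  case less
  have p0: "p > 0" using p prime_gt_0_nat by blast
  have fin: "finite (carrier G)" using G p0 order_gt_0_iff_finite by simp
  have finX: "finite X" using finite_subset[OF X finite_root_characters[OF fin p0]] .
  show ?case
  proof (cases "S = carrier G")
    case True
    have "restrict \<chi> S = \<chi>" if "\<chi> \<in> X" for \<chi>
      using that X by (auto simp: True root_characters_def)
    then have "(\<lambda>\<chi>. restrict \<chi> S) ` X = X" by force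
    then show ?thesis by (simp add: True order_def)
  next
    case False
    have SG: "S \<subseteq> carrier G" using less.prems subgroup.subset by blast
    then obtain x where x: "x \<in> carrier G" "x \<notin> S" using False by blast
    define T where "T = generate G (insert x S)"
    have sub: "insert x S \<subseteq> carrier G" using x SG by blast
    have T: "subgroup T G" unfolding T_def using sub by (rule generate_is_subgroup)
    have ST: "insert x S \<subseteq> T" unfolding T_def by (auto intro: generate.incl)
    have "S \<subset> T" using ST x by blast
    then have card: "p * card S \<le> card T" using card_subgroup_strict[OF p G less.prems T] by blast
    have "card S > 0"
      using subgroup.one_closed[OF less.prems] finite_subset[OF SG fin] by (auto simp: card_gt_0_iff)
    moreover have "card T \<le> order G" using subgroup.subset[OF T] fin by (simp add: order_def card_mono)
    moreover have "p > 1" using p prime_gt_1_nat by blast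
    ultimately have "card S < p * card S" "card T \<le> order G" by auto
    then have "order G - card T < order G - card S" using card by linarith
    then have IH: "card X * card T \<le> card ((\<lambda>\<chi>. restrict \<chi> T) ` X) * order G" using less.hyps T by blast
    have roots: "finite {w::complex. w ^ p = 1}" "card {w::complex. w ^ p = 1} \<le> p"
      using finite_roots_unity[of p] card_roots_unity[of p] p0 by auto
    have "card ((\<lambda>\<chi>. restrict \<chi> T) ` X) \<le> card ((\<lambda>\<chi>. restrict \<chi> S) ` X \<times> {w::complex. w ^ p = 1})"
    proof (rule card_inj_on_le[where f = "\<lambda>\<psi>. (restrict \<psi> S, \<psi> x)"])
      show "inj_on (\<lambda>\<psi>. (restrict \<psi> S, \<psi> x)) ((\<lambda>\<chi>. restrict \<chi> T) ` X)"
      proof (rule inj_onI, clarify)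
        fix \<chi> \<chi>' assume c: "\<chi> \<in> X" "\<chi>' \<in> X" "restrict \<chi> T x = restrict \<chi>' T x"
          "restrict (restrict \<chi> T) S = restrict (restrict \<chi>' T) S"
        have "\<chi> s = \<chi>' s" if "s \<in> insert x S" for s
          using fun_cong[OF c(4), of s] c(3) ST that by (auto split: if_splits)
        then have "\<chi> t = \<chi>' t" if "t \<in> T" for t
          using root_character_determined_generate[of \<chi> p \<chi>' "insert x S" t] c X p0 sub that T_def by blast
        then show "restrict \<chi> T = restrict \<chi>' T" by (auto simp: restrict_def)
      qed
      have "restrict (restrict \<chi> T) S = restrict \<chi> S" for \<chi> :: "'a \<Rightarrow> complex"
        using ST by (auto simp: restrict_def fun_eq_iff)
      then show "(\<lambda>\<psi>. (restrict \<psi> S, \<psi> x)) ` (\<lambda>\<chi>. restrict \<chi> T) ` X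
        \<subseteq> (\<lambda>\<chi>. restrict \<chi> S) ` X \<times> {w. w ^ p = 1}"
        using ST X root_characterD(1)[OF _ x(1)] by auto
    qed (use finX roots in auto)
    also have "\<dots> \<le> card ((\<lambda>\<chi>. restrict \<chi> S) ` X) * p"
      using roots by (simp add: card_cartesian_product)
    finally have "card X * card T \<le> card ((\<lambda>\<chi>. restrict \<chi> S) ` X) * p * order G"
      using IH by (meson le_trans mult_le_mono1)
    moreover have "card X * (p * card S) \<le> card X * card T" using card by (rule mult_le_mono2)
    ultimately have "card X * (p * card S) \<le> card ((\<lambda>\<chi>. restrict \<chi> S) ` X) * p * order G"
      by linarith
    then have "p * (card X * card S) \<le> p * (card ((\<lambda>\<chi>. restrict \<chi> S) ` X) * order G)"
      by (simp add: mult_ac)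
    then show ?thesis using p0 by simp
  qed
qed

lemma card_root_characters_trivial_on:
  assumes p: "prime p" and G: "order G = p ^ n" and X: "X \<subseteq> root_characters p" and S: "subgroup S G"
    and triv: "\<And>\<chi> s. \<chi> \<in> X \<Longrightarrow> s \<in> S \<Longrightarrow> \<chi> s = 1"
  shows "card X * card S \<le> order G"
proof -
  have "(\<lambda>\<chi>. restrict \<chi> S) ` X \<subseteq> {restrict (\<lambda>_. 1) S}" using triv by (auto simp: restrict_def)
  then have "card ((\<lambda>\<chi>. restrict \<chi> S) ` X) \<le> 1" using card_mono[of "{restrict (\<lambda>_. 1) S}"] by simp
  then have "card ((\<lambda>\<chi>. restrict \<chi> S) ` X) * order G \<le> 1 * order G" by (rule mult_le_mono1)
  then show ?thesis using card_root_characters_restriction[OF p G X S] by linarith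
qed

end

section \<open>Comparing the multipliers of a group and of its quotient\<close>

context central_prime
begin

text \<open>The image of the homomorphism $f \mapsto \chi_f$ from $M(G)$ to the characters of $G$. All bounds
  below come from estimates of its size.\<close>

definition pairings :: "('a \<Rightarrow> complex) set" where
  "pairings = {restrict (pairing f z) (carrier G) | f. cocycle G f}"

lemma pairings_root_characters: "pairings \<subseteq> root_characters p"
proof
  fix \<chi> assume "\<chi> \<in> pairings"
  then obtain f where f: "cocycle G f" and \<chi>: "\<chi> = restrict (pairing f z) (carrier G)"
    by (auto simp: pairings_def)
  have "pairing f z g ^ p = 1" if "g \<in> carrier G" for g
    using pairing_pow_left[OF f that z_closed, of p] K_comm[OF z_in_K that] pairing_one[OF f that]
    by (simp add: z_pow)
  moreover have "pairing f z (g \<otimes> h) = pairing f z g * pairing f z h"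
    if "g \<in> carrier G" "h \<in> carrier G" for g h
    using pairing_mult_right[OF f z_closed that] K_comm[OF z_in_K] that by simp
  ultimately show "\<chi> \<in> root_characters p" by (simp add: root_characters_def \<chi>)
qed

lemma pairing_cong:
  assumes f: "cocycle G f" "cocycle G f'" and g: "g \<in> carrier G" and k: "k \<in> K"
    and e: "pairing f z g = pairing f' z g"
  shows "pairing f k g = pairing f' k g"
proof -
  obtain i :: nat where "k = z [^] i" using k by (auto simp: K_def)
  then show ?thesis
    using pairing_pow_left[OF f(1) g z_closed] pairing_pow_left[OF f(2) g z_closed] e K_comm[OF z_in_K g]
    by simp
qed

lemma is_coboundary_inflated_transgression:
  assumes "K_character \<eta>"
  shows "is_coboundary G (\<lambda>(g, h). transgression \<eta> (rep g, rep h))"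
  unfolding is_coboundary_def
  by (intro exI[of _ "\<lambda>g. inverse (\<eta> (residue g))"] conjI ballI)
    (use assms in \<open>simp_all add: inflated_transgression K_character_def residue_in_K divide_inverse mult_ac\<close>)

text \<open>The injection behind the inequality: for a class $r$ of $G$ let $b$ be the chosen class with the same
  pairing. Then $r / b$ is inflated from a class $q$ of the quotient, and $(r, \eta)$ is sent to the class
  of $q$ times the transgression of $\eta$, together with the pairing of $r$. This is injective because
  inflation forgets $\eta$ and thereby recovers $r$, and then $q$ and the class of the transgression are
  known.\<close>

lemma order_schur_multiplier_le:
  assumes fin: "finite (carrier G)" and H: "finite H" "\<And>\<eta>. \<eta> \<in> H \<Longrightarrow> K_character \<eta>"
    and sep: "\<And>\<eta> \<eta>'. \<eta> \<in> H \<Longrightarrow> \<eta>' \<in> H \<Longrightarrow> cohomologous Q (transgression \<eta>) (transgression \<eta>') \<Longrightarrow> \<eta> = \<eta>'"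
  shows "order (schur_multiplier G) * card H \<le> order (schur_multiplier Q) * card pairings"
proof -
  interpret Q: group Q by (rule group_Q)
  obtain R where R: "finite R" "card R = order (schur_multiplier G)"
    "\<And>r. r \<in> R \<Longrightarrow> cocycle G r"
    "\<And>r r'. r \<in> R \<Longrightarrow> r' \<in> R \<Longrightarrow> cohomologous G r r' \<Longrightarrow> r = r'"
    using cohomology_transversal[OF fin] by metis
  obtain S where S: "finite S" "card S = order (schur_multiplier Q)"
    "\<And>s. s \<in> S \<Longrightarrow> cocycle Q s"
    "\<And>f. cocycle Q f \<Longrightarrow> \<exists>s\<in>S. cohomologous Q f s"
    using Q.cohomology_transversal[OF finite_Q[OF fin]] by metis
  define \<theta> where "\<theta> r = restrict (pairing r z) (carrier G)" for r
  define b where "b \<chi> = (SOME r. r \<in> R \<and> \<theta> r = \<chi>)" for \<chi>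
  have b: "b (\<theta> r) \<in> R" "\<theta> (b (\<theta> r)) = \<theta> r" if "r \<in> R" for r
    using someI[of "\<lambda>r'. r' \<in> R \<and> \<theta> r' = \<theta> r" r] that by (auto simp: b_def)
  have "\<exists>q. cocycle Q q \<and> cohomologous G (\<lambda>s. r s / b (\<theta> r) s) (\<lambda>(g, h). q (rep g, rep h))"
    if r: "r \<in> R" for r
  proof -
    let ?d = "\<lambda>s. r s / b (\<theta> r) s"
    have c: "cocycle G r" "cocycle G (b (\<theta> r))" using R(3) r b by blast+
    have one: "pairing ?d z g = 1" if g: "g \<in> carrier G" for g
    proof -
      have "pairing (b (\<theta> r)) z g = pairing r z g"
        using fun_cong[OF b(2)[OF r], of g] g by (simp add: \<theta>_def)
      moreover have "pairing ?d z g = pairing r z g / pairing (b (\<theta> r)) z g"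
        by (simp add: pairing_def)
      ultimately show ?thesis using pairing_nonzero[OF c(1) z_closed g] by simp
    qed
    obtain q where "cocycle Q q" "cohomologous G ?d (\<lambda>(g, h). q (rep g, rep h))"
      by (rule cohomologous_to_inflation[OF cocycle_divide[OF c] one])
    then show ?thesis by blast
  qed
  then have "\<forall>r\<in>R. \<exists>q. cocycle Q q \<and> cohomologous G (\<lambda>s. r s / b (\<theta> r) s) (\<lambda>(g, h). q (rep g, rep h))"
    by blast
  from bchoice[OF this] obtain q where q: "\<And>r. r \<in> R \<Longrightarrow> cocycle Q (q r)"
    "\<And>r. r \<in> R \<Longrightarrow> cohomologous G (\<lambda>s. r s / b (\<theta> r) s) (\<lambda>(g, h). q r (rep g, rep h))"
    by blast
  let ?c = "\<lambda>r \<eta> s. q r s * transgression \<eta> s"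
  have cc: "cocycle Q (?c r \<eta>)" if "r \<in> R" "\<eta> \<in> H" for r \<eta>
    using that by (intro cocycle_mult q cocycle_transgression H)
  define a where "a r \<eta> = (SOME s. s \<in> S \<and> cohomologous Q (?c r \<eta>) s)" for r \<eta>
  have a: "a r \<eta> \<in> S" "cohomologous Q (?c r \<eta>) (a r \<eta>)" if "r \<in> R" "\<eta> \<in> H" for r \<eta>
    using someI_ex[of "\<lambda>s. s \<in> S \<and> cohomologous Q (?c r \<eta>) s"] S(4)[OF cc[OF that]] by (auto simp: a_def)
  have finP: "finite pairings"
    using finite_subset[OF pairings_root_characters finite_root_characters[OF fin]] p_gt_1 by simp
  have "card (R \<times> H) \<le> card (S \<times> pairings)"
  proof (rule card_inj_on_le[where f = "\<lambda>(r, \<eta>). (a r \<eta>, \<theta> r)"])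
    show "finite (S \<times> pairings)" using S(1) finP by simp
    show "(\<lambda>(r, \<eta>). (a r \<eta>, \<theta> r)) ` (R \<times> H) \<subseteq> S \<times> pairings"
      using a R(3) by (auto simp: pairings_def \<theta>_def)
    show "inj_on (\<lambda>(r, \<eta>). (a r \<eta>, \<theta> r)) (R \<times> H)"
    proof (rule inj_onI, clarify)
      fix r \<eta> r' \<eta>' assume r: "r \<in> R" "r' \<in> R" and \<eta>: "\<eta> \<in> H" "\<eta>' \<in> H"
        and e: "a r \<eta> = a r' \<eta>'" "\<theta> r = \<theta> r'"
      have "cohomologous Q (?c r \<eta>) (a r' \<eta>')" using a(2)[OF r(1) \<eta>(1)] e(1) by simp
      then have coh: "cohomologous Q (?c r \<eta>) (?c r' \<eta>')"
        using cohomologous_sym[OF a(2)[OF r(2) \<eta>(2)]] S(3)[OF a(1)[OF r(2) \<eta>(2)]]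
        by (rule cohomologous_trans)
      let ?inf = "\<lambda>q (g, h). q (rep g, rep h) :: complex"
      note cb = cohomologous_def[THEN iffD1]
      have q': "cohomologous G (\<lambda>s. r' s / b (\<theta> r) s) (?inf (q r'))"
        using q(2)[OF r(2)] e(2) by simp
      \<comment> \<open>The factors $b$, $q$ and $\eta$ cancel in this product of coboundaries, which leaves $r / r'$.\<close>
      have "is_coboundary G (\<lambda>s. (r s / b (\<theta> r) s / ?inf (q r) s) * inverse (r' s / b (\<theta> r) s / ?inf (q r') s)
          * (?inf (?c r \<eta>) s / ?inf (?c r' \<eta>') s)
          * inverse (?inf (transgression \<eta>) s) * ?inf (transgression \<eta>') s)"
        by (intro is_coboundary_mult is_coboundary_inverse is_coboundary_inflated_transgression H \<eta>
            cb[OF q(2)[OF r(1)]] cb[OF q'] cb[OF cohomologous_inflation[OF coh]])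
      then have "is_coboundary G (\<lambda>s. r s / r' s)"
      proof (rule is_coboundary_cong[rotated])
        fix x y assume xy: "x \<in> carrier G" "y \<in> carrier G"
        have "b (\<theta> r) (x, y) \<noteq> 0" "r (x, y) \<noteq> 0" "r' (x, y) \<noteq> 0"
          using cocycleD(1)[OF R(3) xy] r b(1)[OF r(1)] by auto
        moreover have "q r (rep x, rep y) \<noteq> 0" "q r' (rep x, rep y) \<noteq> 0"
          "transgression \<eta> (rep x, rep y) \<noteq> 0" "transgression \<eta>' (rep x, rep y) \<noteq> 0"
          using cocycleD(1)[OF q(1) Q_closed Q_closed, OF _ xy]
            cocycleD(1)[OF cocycle_transgression[OF H(2)] Q_closed Q_closed, OF _ xy] r \<eta> by auto
        ultimately show "(r (x, y) / b (\<theta> r) (x, y) / ?inf (q r) (x, y))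
          * inverse (r' (x, y) / b (\<theta> r) (x, y) / ?inf (q r') (x, y))
          * (?inf (?c r \<eta>) (x, y) / ?inf (?c r' \<eta>') (x, y))
          * inverse (?inf (transgression \<eta>) (x, y)) * ?inf (transgression \<eta>') (x, y) = r (x, y) / r' (x, y)"
          by simp
      qed
      then have rr: "r = r'" using R(4)[OF r] by (simp add: cohomologous_def)
      have "cohomologous Q (transgression \<eta>) (transgression \<eta>')"
        using coh unfolding cohomologous_def rr
        by (rule is_coboundary_cong[rotated]) (use cocycleD(1)[OF q(1)[OF r(2)]] in simp)
      then show "r = r' \<and> \<eta> = \<eta>'" using rr sep[OF \<eta>] by simp
    qed
  qed
  then show ?thesis by (simp add: card_cartesian_product R S)
qed

lemma order_schur_multiplier_le_quotient:
  assumes fin: "finite (carrier G)"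
  shows "order (schur_multiplier G) \<le> order (schur_multiplier Q) * card pairings"
  using order_schur_multiplier_le[OF fin, of "{\<lambda>_. 1}"] by (simp add: K_character_def)

text \<open>A homomorphism of $G$ to $\mathbb{C}^\times$ is trivial on $G'$, so for $z \in G'$ all $p$ powers of a faithful character
  of $K$ have different transgression classes.\<close>

lemma order_schur_multiplier_le_quotient_derived:
  assumes fin: "finite (carrier G)" and z: "z \<in> derived G (carrier G)"
  shows "order (schur_multiplier G) * p \<le> order (schur_multiplier Q) * card pairings"
proof -
  have "card {w::complex. w ^ p = 1} = p" using p_gt_1 by (intro card_roots_unity_eq) auto
  then have "{w::complex. w ^ p = 1} \<noteq> {1}" using p_gt_1 by auto
  then obtain \<omega> :: complex where \<omega>: "\<omega> ^ p = 1" "\<omega> \<noteq> 1" by auto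
  have \<omega>0: "\<omega> \<noteq> 0" using \<omega>(1) p_gt_1 by (auto simp: power_0_left)
  have \<omega>_inj: "i = j" if ij: "i \<le> j" "j < p" and e: "\<omega> ^ i = \<omega> ^ j" for i j
  proof (rule ccontr)
    assume "i \<noteq> j"
    then have "\<not> p dvd (j - i)" using ij by (auto dest: dvd_imp_le)
    then have "coprime (j - i) p" using prime by (simp add: prime_imp_coprime coprime_commute)
    moreover have "j - i \<noteq> 0" using \<open>i \<noteq> j\<close> ij by simp
    ultimately obtain x y where xy: "(j - i) * x = p * y + 1"
      using bezout_nat[of "j - i" p] by auto
    have "\<omega> ^ (j - i) = 1" using e ij(1) \<omega>0 by (metis le_add_diff_inverse mult_cancel_left2 power_add power_not_zero)
    then have "\<omega> ^ ((j - i) * x) = 1" by (simp add: power_mult)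
    then show False using xy \<omega> by (simp add: power_add power_mult)
  qed
  have \<omega>_inj': "i = j" if "i < p" "j < p" and e: "\<omega> ^ i = \<omega> ^ j" for i j
  proof (cases "i \<le> j")
    case True
    then show ?thesis using \<omega>_inj[OF _ \<open>j < p\<close> e] by blast
  next
    case False
    then have "j \<le> i" by simp
    then show ?thesis using \<omega>_inj[OF _ \<open>i < p\<close> e[symmetric]] by blast
  qed
  define \<eta> where "\<eta> j k = \<omega> ^ (j * dlog k)" for j k
  have mod: "\<omega> ^ (i mod p) = \<omega> ^ i" for i using \<omega>(1) by (rule power_mod_root_of_unity)
  have \<eta>_z: "\<eta> j z = \<omega> ^ j" for j
  proof -
    have "z [^] dlog z = z [^] (1::nat)" using pow_dlog[OF z_in_K] by simp
    then have "dlog z mod p = 1 mod p" by (simp only: z_pow_eq_iff)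
    then have "(j * dlog z) mod p = j mod p" by (metis mod_mult_right_eq mult.right_neutral)
    then show ?thesis using mod[of "j * dlog z"] mod[of j] by (simp add: \<eta>_def)
  qed
  have char: "K_character (\<eta> j)" for j
  proof -
    have "\<eta> j (k \<otimes> l) = \<eta> j k * \<eta> j l" if "k \<in> K" "l \<in> K" for k l
    proof -
      have "z [^] dlog (k \<otimes> l) = z [^] (dlog k + dlog l)"
        using that by (simp add: pow_dlog K_mult flip: nat_pow_mult)
      then have "dlog (k \<otimes> l) mod p = (dlog k + dlog l) mod p" by (simp only: z_pow_eq_iff)
      then have "(j * dlog (k \<otimes> l)) mod p = (j * (dlog k + dlog l)) mod p" by (metis mod_mult_right_eq)
      then have "\<eta> j (k \<otimes> l) = \<omega> ^ (j * (dlog k + dlog l))" unfolding \<eta>_def by (metis mod)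
      then show ?thesis by (simp add: \<eta>_def distrib_left power_add)
    qed
    then show ?thesis using \<omega>0 by (simp add: K_character_def \<eta>_def)
  qed
  have inj: "inj_on \<eta> {..<p}"
  proof (rule inj_onI)
    fix i j assume ij: "i \<in> {..<p}" "j \<in> {..<p}" "\<eta> i = \<eta> j"
    then have "\<omega> ^ i = \<omega> ^ j" using \<eta>_z by metis
    then show "i = j" using \<omega>_inj' ij(1,2) by blast
  qed
  have "order (schur_multiplier G) * card (\<eta> ` {..<p}) \<le> order (schur_multiplier Q) * card pairings"
  proof (rule order_schur_multiplier_le[OF fin])
    fix e e' assume e: "e \<in> \<eta> ` {..<p}" "e' \<in> \<eta> ` {..<p}"
      and coh: "cohomologous Q (transgression e) (transgression e')"
    then obtain i j where ij: "i < p" "j < p" "e = \<eta> i" "e' = \<eta> j" by auto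
    obtain \<chi> where \<chi>: "\<And>g. g \<in> carrier G \<Longrightarrow> \<chi> g \<noteq> (0::complex)"
      "\<And>g h. g \<in> carrier G \<Longrightarrow> h \<in> carrier G \<Longrightarrow> \<chi> (g \<otimes> h) = \<chi> g * \<chi> h"
      "\<And>k. k \<in> K \<Longrightarrow> \<chi> k * \<eta> j k = \<eta> i k"
      by (rule transgression_cohomologous_imp[OF char char coh[unfolded ij(3,4)]], rule that)
    have "\<chi> z = 1" using hom_one_on_derived[OF \<chi>(1,2) z] .
    then have "\<omega> ^ i = \<omega> ^ j" using \<chi>(3)[OF z_in_K] by (simp add: \<eta>_z)
    then show "e = e'" using \<omega>_inj'[OF ij(1,2)] ij(3,4) by simp
  qed (use char in auto)
  then show ?thesis by (simp add: card_image[OF inj])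
qed

end

section \<open>The lower central series\<close>

context group
begin

lemma lower_central_Suc:
  "lower_central G (Suc i) = generate G {commutator x y |x y. x \<in> lower_central G i \<and> y \<in> carrier G}"
  by (simp add: commutator_def) (rule arg_cong[of _ _ "generate G"], blast)

lemma lower_central_subgroup: "subgroup (lower_central G i) G"
proof (induction i)
  case (Suc i)
  then show ?case unfolding lower_central_Suc
    by (intro generate_is_subgroup) (auto dest: subgroup.mem_carrier)
qed (simp add: subgroup_self)

lemma lower_central_closed: "x \<in> lower_central G i \<Longrightarrow> x \<in> carrier G"
  using lower_central_subgroup subgroup.mem_carrier by metis

lemma commutator_in_lower_central:
  "x \<in> lower_central G i \<Longrightarrow> y \<in> carrier G \<Longrightarrow> commutator x y \<in> lower_central G (Suc i)"
  unfolding lower_central_Suc by (auto intro: generate.incl)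

end

lemma (in group_hom) hom_commutator:
  "x \<in> carrier G \<Longrightarrow> y \<in> carrier G \<Longrightarrow> h (G.commutator x y) = H.commutator (h x) (h y)"
  by (simp add: G.commutator_def H.commutator_def)

text \<open>Applied to conjugations this shows that the terms of the series are normal, and applied to the
  projection onto a quotient it describes the series of the quotient.\<close>

lemma (in group_hom) lower_central_image:
  assumes "h ` carrier G = carrier H"
  shows "lower_central H i = h ` lower_central G i"
proof (induction i)
  case (Suc i)
  have "h ` {G.commutator x y |x y. x \<in> lower_central G i \<and> y \<in> carrier G}
      = {H.commutator x y |x y. x \<in> lower_central H i \<and> y \<in> carrier H}" (is "h ` ?A = ?B")
  proof
    show "h ` ?A \<subseteq> ?B"
    proof
      fix w assume "w \<in> h ` ?A"
      then obtain x y where "w = h (G.commutator x y)" "x \<in> lower_central G i" "y \<in> carrier G"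
        by blast
      then have "w = H.commutator (h x) (h y)" "h x \<in> lower_central H i" "h y \<in> carrier H"
        using G.lower_central_closed[of x i] Suc by (simp_all add: hom_commutator)
      then show "w \<in> ?B" by blast
    qed
    show "?B \<subseteq> h ` ?A"
    proof
      fix w assume "w \<in> ?B"
      then obtain x y where "w = H.commutator (h x) (h y)" "x \<in> lower_central G i" "y \<in> carrier G"
        using Suc unfolding assms[symmetric] by auto
      then show "w \<in> h ` ?A" using G.lower_central_closed[of x i]
        by (intro image_eqI[of _ _ "G.commutator x y"]) (auto simp: hom_commutator)
    qed
  qed
  moreover have "?A \<subseteq> carrier G" using G.lower_central_closed by blast
  ultimately show ?case unfolding G.lower_central_Suc H.lower_central_Suc
    by (metis (no_types, lifting) generate_img)
qed (simp add: assms)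

context group
begin

lemma conjugate_hom: assumes "g \<in> carrier G" shows "group_hom G G (conjugate g)"
proof -
  have "conjugate g \<in> hom G G"
    using assms by (auto simp: hom_def word_simps)
  then show ?thesis by (simp add: group_hom_def group_hom_axioms_def is_group)
qed

lemma conjugate_lower_central:
  assumes "g \<in> carrier G" "x \<in> lower_central G i"
  shows "conjugate g x \<in> lower_central G i"
proof -
  have "conjugate g ` carrier G = carrier G"
  proof
    show "carrier G \<subseteq> conjugate g ` carrier G"
    proof
      fix x assume "x \<in> carrier G"
      then show "x \<in> conjugate g ` carrier G" using assms
        by (intro image_eqI[of _ _ "conjugate (inv g) x"]) (simp_all add: word_simps)
    qed
  qed (use assms in auto)
  from group_hom.lower_central_image[OF conjugate_hom[OF assms(1)] this]
  show ?thesis using assms by blast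
qed

lemma lower_central_Suc_subset: "lower_central G (Suc i) \<subseteq> lower_central G i"
  unfolding lower_central_Suc
proof (rule generate_subgroup_incl[OF _ lower_central_subgroup], safe)
  fix x y assume x: "x \<in> lower_central G i" and y: "y \<in> carrier G"
  have xc: "x \<in> carrier G" using x lower_central_closed by blast
  have "commutator x y = x \<otimes> inv (conjugate y x)" using xc y by (simp add: word_simps)
  moreover have "inv (conjugate y x) \<in> lower_central G i"
    using conjugate_lower_central[OF y x] lower_central_subgroup subgroup.m_inv_closed by metis
  ultimately show "commutator x y \<in> lower_central G i"
    using x lower_central_subgroup subgroup.m_closed by metis
qed

lemma lower_central_antimono: "i \<le> j \<Longrightarrow> lower_central G j \<subseteq> lower_central G i"
  by (induction j rule: dec_induct) (use lower_central_Suc_subset in blast)+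

lemma generate_trivial: "generate G {\<one>} = {\<one>}"
  using generate_subgroup_incl[of "{\<one>}" "{\<one>}"] triv_subgroup generate.one[of G "{\<one>}"] by blast

lemma lower_central_Suc_trivial_iff:
  "lower_central G (Suc i) = {\<one>} \<longleftrightarrow> (\<forall>x\<in>lower_central G i. central x)"
proof
  assume e: "lower_central G (Suc i) = {\<one>}"
  show "\<forall>x\<in>lower_central G i. central x"
  proof
    fix x assume x: "x \<in> lower_central G i"
    have "commutator x y = \<one>" if "y \<in> carrier G" for y
      using commutator_in_lower_central[OF x that] e by simp
    then show "central x" using lower_central_closed[OF x] by (simp add: central_def commutator_eq_one_iff)
  qed
next
  assume "\<forall>x\<in>lower_central G i. central x"
  then have "{commutator x y |x y. x \<in> lower_central G i \<and> y \<in> carrier G} \<subseteq> {\<one>}"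
    using commutator_central_left by auto
  then have "lower_central G (Suc i) \<subseteq> generate G {\<one>}"
    unfolding lower_central_Suc by (rule mono_generate)
  then show "lower_central G (Suc i) = {\<one>}"
    using generate_trivial subgroup.one_closed[OF lower_central_subgroup[of "Suc i"]] by blast
qed

text \<open>The last nontrivial term of the series is central and is contained in every earlier term.\<close>

lemma exists_central_in_lower_central:
  assumes nil: "lower_central G c = {\<one>}" and i: "lower_central G i \<noteq> {\<one>}"
  obtains x where "x \<in> lower_central G i" "central x" "x \<noteq> \<one>"
proof -
  define d where "d = (LEAST d. lower_central G d = {\<one>})"
  have d: "lower_central G d = {\<one>}" unfolding d_def using nil by (rule LeastI)
  have "i < d"
  proof (rule ccontr)
    assume "\<not> i < d"
    then have "lower_central G i \<subseteq> {\<one>}" using lower_central_antimono[of d i] d by simp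
    then show False using i subgroup.one_closed[OF lower_central_subgroup[of i]] by blast
  qed
  then obtain e where e: "d = Suc e" "i \<le> e" by (cases d) auto
  have "lower_central G e \<noteq> {\<one>}" using not_less_Least[of e "\<lambda>d. lower_central G d = {\<one>}"] e d_def by simp
  then obtain x where x: "x \<in> lower_central G e" "x \<noteq> \<one>"
    using subgroup.one_closed[OF lower_central_subgroup[of e]] by blast
  show thesis
    using that[of x] x d e lower_central_Suc_trivial_iff[of e] lower_central_antimono[OF e(2)] by blast
qed

lemma subgroup_pow_closed: "subgroup S G \<Longrightarrow> x \<in> S \<Longrightarrow> x [^] (i::nat) \<in> S"
  by (induction i) (simp_all add: subgroup.one_closed subgroup.m_closed)

lemma exists_power_of_prime_order:
  assumes p: "prime p" and G: "order G = p ^ n" and x: "x \<in> carrier G" "x \<noteq> \<one>"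
  obtains i :: nat where "x [^] i \<noteq> \<one>" "(x [^] i) [^] p = \<one>"
proof -
  have "ord x dvd p ^ n" using ord_dvd_group_order[OF x(1)] G by simp
  then obtain j where j: "ord x = p ^ j" using divides_primepow_nat[OF p] by blast
  have "j \<noteq> 0" using j x ord_eq_1[OF x(1)] by (intro notI) simp
  then obtain l where l: "j = Suc l" by (cases j) auto
  have "p ^ l > 0" "p ^ l < p ^ Suc l" using p prime_gt_1_nat[OF p] by simp_all
  then have "\<not> ord x dvd p ^ l" using j l by (metis dvd_imp_le not_less)
  then have "x [^] (p ^ l) \<noteq> \<one>" using pow_eq_id[OF x(1)] by blast
  moreover have "(x [^] (p ^ l)) [^] p = \<one>"
    using pow_ord_eq_1[OF x(1)] j l x by (simp add: nat_pow_pow mult.commute)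
  ultimately show thesis using that by blast
qed

lemma exists_central_prime:
  assumes p: "prime p" and G: "order G = p ^ n" and x: "x \<in> S" "subgroup S G" "central x" "x \<noteq> \<one>"
  obtains z where "z \<in> S" "central_prime G p z"
proof -
  obtain i :: nat where i: "x [^] i \<noteq> \<one>" "(x [^] i) [^] p = \<one>"
    using exists_power_of_prime_order[OF p G centralD(1)[OF x(3)] x(4)] by metis
  have "central (x [^] i)" by (induction i) (simp_all add: x)
  then have "central_prime G p (x [^] i)"
    by (intro central_prime.intro central_prime_axioms.intro is_group p i)
  then show thesis using that subgroup_pow_closed[OF x(2,1)] by blast
qed

lemma subgroup_centralizer:
  assumes x: "x \<in> carrier G" shows "subgroup {g \<in> carrier G. x \<otimes> g = g \<otimes> x} G"
proof (rule subgroupI)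
  fix g assume g: "g \<in> {g \<in> carrier G. x \<otimes> g = g \<otimes> x}"
  then have gc: "g \<in> carrier G" by simp
  have "inv g \<otimes> x = inv g \<otimes> (x \<otimes> g) \<otimes> inv g" using gc x by (simp add: m_assoc)
  also have "\<dots> = inv g \<otimes> (g \<otimes> x) \<otimes> inv g" using g by simp
  also have "\<dots> = x \<otimes> inv g" using gc x by (simp add: word_simps)
  finally have "inv g \<otimes> x = x \<otimes> inv g" .
  then show "inv g \<in> {g \<in> carrier G. x \<otimes> g = g \<otimes> x}" using g by simp
next
  fix g h assume g: "g \<in> {g \<in> carrier G. x \<otimes> g = g \<otimes> x}" "h \<in> {g \<in> carrier G. x \<otimes> g = g \<otimes> x}"
  have "x \<otimes> (g \<otimes> h) = g \<otimes> x \<otimes> h" using g x by (simp flip: m_assoc)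
  also have "\<dots> = g \<otimes> h \<otimes> x" using g x by (simp add: m_assoc)
  finally show "g \<otimes> h \<in> {g \<in> carrier G. x \<otimes> g = g \<otimes> x}" using g by simp
qed (use x in auto)

end

context central_prime
begin

lemma lower_central_Q: "lower_central Q i = rep ` lower_central G i"
  using group_hom.lower_central_image[OF rep_hom rep_surj] .

lemma lower_central_Q_trivial_iff: "lower_central Q i = {\<one>\<^bsub>Q\<^esub>} \<longleftrightarrow> lower_central G i \<subseteq> K"
proof -
  have "\<one> \<in> lower_central G i" using lower_central_subgroup subgroup.one_closed by metis
  then have "lower_central Q i = {\<one>\<^bsub>Q\<^esub>} \<longleftrightarrow> (\<forall>x\<in>lower_central G i. rep x = \<one>\<^bsub>Q\<^esub>)"
    unfolding lower_central_Q by auto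
  also have "\<dots> \<longleftrightarrow> lower_central G i \<subseteq> K"
    using rep_eq_one_iff[OF lower_central_closed] by (auto simp only: subset_iff)
  finally show ?thesis .
qed

lemma nilpotent_Q: "lower_central G c = {\<one>} \<Longrightarrow> lower_central Q c = {\<one>\<^bsub>Q\<^esub>}"
  using one_in_K by (simp add: lower_central_Q_trivial_iff)

lemma card_lower_central_Q:
  "z \<in> lower_central G i \<Longrightarrow> card (lower_central G i) = card (lower_central Q i) * p"
  using card_image_rep[OF lower_central_subgroup K_subset_subgroup[OF lower_central_subgroup]]
  by (simp add: lower_central_Q)

lemma central_prime_of_K: "k \<in> K \<Longrightarrow> k \<noteq> \<one> \<Longrightarrow> central_prime G p k"
  using K_central prime subgroup_pow_closed
  by (auto intro!: central_prime.intro central_prime_axioms.intro is_group simp: K_def nat_pow_pow z_pow_eq_iff[of _ 0, simplified])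

text \<open>Any nontrivial element may replace $z$ as generator of $K$; the generator is later chosen to be a
  commutator.\<close>

lemma K_of_K:
  assumes k: "k \<in> K" "k \<noteq> \<one>" shows "central_prime.K G k = K"
proof -
  interpret k: central_prime G p k using central_prime_of_K[OF k] .
  show ?thesis using k.K_subset_subgroup[OF subgroup_K k(1)] finite_K card_K k.card_K card_subset_eq by metis
qed

end

section \<open>Restrictions on the pairing in class two\<close>

lemma (in group) card_root_characters_le_square:
  assumes p: "p > 0" and X: "X \<subseteq> root_characters p" and ab: "a \<in> carrier G" "b \<in> carrier G"
    and det: "\<And>\<chi> \<chi>'. \<chi> \<in> X \<Longrightarrow> \<chi>' \<in> X \<Longrightarrow> \<chi> a = \<chi>' a \<Longrightarrow> \<chi> b = \<chi>' b \<Longrightarrow> \<chi> = \<chi>'"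
  shows "card X \<le> p * p"
proof -
  let ?W = "{w::complex. w ^ p = 1}"
  have W: "finite ?W" "card ?W \<le> p" using finite_roots_unity[of p] card_roots_unity[of p] p by auto
  have "card X \<le> card (?W \<times> ?W)"
    by (rule card_inj_on_le[where f = "\<lambda>\<chi>. (\<chi> a, \<chi> b)"])
      (use det X root_characterD(1) ab W in \<open>auto simp: inj_on_def\<close>)
  also have "\<dots> \<le> p * p" using W by (simp add: card_cartesian_product mult_le_mono)
  finally show ?thesis .
qed

lemma (in group) card_root_characters_le:
  assumes p: "p > 0" and X: "X \<subseteq> root_characters p" and b: "b \<in> carrier G"
    and det: "\<And>\<chi> \<chi>'. \<chi> \<in> X \<Longrightarrow> \<chi>' \<in> X \<Longrightarrow> \<chi> b = \<chi>' b \<Longrightarrow> \<chi> = \<chi>'"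
  shows "card X \<le> p"
proof -
  let ?W = "{w::complex. w ^ p = 1}"
  have W: "finite ?W" "card ?W \<le> p" using finite_roots_unity[of p] card_roots_unity[of p] p by auto
  have "card X \<le> card ?W"
    by (rule card_inj_on_le[where f = "\<lambda>\<chi>. \<chi> b"])
      (use det X root_characterD(1) b W in \<open>auto simp: inj_on_def\<close>)
  with W show ?thesis by simp
qed

context central_prime
begin

lemma pairingsE:
  assumes "\<chi> \<in> pairings"
  obtains f where "cocycle G f" "\<And>g. g \<in> carrier G \<Longrightarrow> \<chi> g = pairing f z g" "\<chi> = restrict (pairing f z) (carrier G)"
  using assms by (auto simp: pairings_def)

lemma pairings_eqI:
  assumes "\<chi> \<in> pairings" "\<chi>' \<in> pairings" "\<And>g. g \<in> carrier G \<Longrightarrow> \<chi> g = \<chi>' g"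
  shows "\<chi> = \<chi>'"
  using assms by (auto simp: pairings_def intro!: restrict_ext)

lemma pairings_trivial_on_K:
  assumes "\<chi> \<in> pairings" "k \<in> K" shows "\<chi> k = 1"
proof -
  obtain f where f: "cocycle G f" "\<And>g. g \<in> carrier G \<Longrightarrow> \<chi> g = pairing f z g"
    using pairingsE[OF assms(1)] by metis
  have "f (k, z) = f (z, k)"
    using pairing_K_eq_one[OF f(1) pairing_self[OF f(1) z_closed] z_closed assms(2)] .
  then show ?thesis using f K_closed[OF assms(2)] cocycleD(1)[OF f(1) z_closed] by (simp add: pairing_def)
qed

lemma pairings_trivial_on_derived:
  assumes "\<chi> \<in> pairings" "x \<in> derived G (carrier G)" shows "\<chi> x = 1"
  using hom_one_on_derived[of \<chi>, OF _ _ assms(2)] pairings_root_characters assms(1)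
    root_character_nonzero[of \<chi> p] root_characterD(2)[of \<chi> p] p_gt_1 by auto

lemma card_pairings_K:
  assumes "order G = p ^ n" shows "card pairings * p \<le> order G"
proof -
  have "card pairings * card K \<le> order G"
    by (rule card_root_characters_trivial_on[OF prime assms pairings_root_characters subgroup_K])
      (rule pairings_trivial_on_K)
  then show ?thesis by (simp only: card_K)
qed

lemma card_pairings_derived:
  assumes "order G = p ^ n" shows "card pairings * card (derived G (carrier G)) \<le> order G"
  by (rule card_root_characters_trivial_on[OF prime assms pairings_root_characters])
    (use pairings_trivial_on_derived in \<open>auto intro: derived_is_subgroup\<close>)

lemma pairing_K_mult:
  assumes f: "cocycle G f" and k: "k \<in> K" and c: "g \<in> carrier G" "h \<in> carrier G"
  shows "pairing f k (g \<otimes> h) = pairing f k g * pairing f k h"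
  using pairing_mult_right[OF f K_closed[OF k] c] K_comm[OF k] c by simp

lemma pairing_K_commutator:
  assumes f: "cocycle G f" and k: "k \<in> K" and c: "g \<in> carrier G" "h \<in> carrier G"
  shows "pairing f k (commutator g h) = 1"
proof -
  have "pairing f k (commutator g h) * pairing f k (h \<otimes> g) = pairing f k (g \<otimes> h)"
    using pairing_K_mult[OF f k, of "commutator g h" "h \<otimes> g"] c by (simp add: word_simps)
  moreover have "pairing f k (h \<otimes> g) = pairing f k (g \<otimes> h)"
    using pairing_K_mult[OF f k] c by (simp add: mult.commute)
  moreover have "pairing f k (g \<otimes> h) \<noteq> 0" using pairing_nonzero[OF f K_closed[OF k]] c by simp
  ultimately show ?thesis by simp
qed

lemma pairing_K_conjugate:
  assumes f: "cocycle G f" and k: "k \<in> K" and c: "g \<in> carrier G" "h \<in> carrier G"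
  shows "pairing f k (conjugate g h) = pairing f k h"
  using pairing_K_mult[OF f k, of "commutator g h" h] pairing_K_commutator[OF f k c] c
  by (simp add: conjugate_eq_commutator_mult)

text \<open>Hall-Witt for $x, y, w$ expresses the value at $w$ through the values of the pairing with elements of $K$
  at $x$ and $y$.\<close>

lemma pairings_determined_class2:
  assumes K: "\<And>g h. g \<in> carrier G \<Longrightarrow> h \<in> carrier G \<Longrightarrow> commutator g h \<in> K"
    and z: "z = commutator x y" and c: "x \<in> carrier G" "y \<in> carrier G"
    and X: "\<chi> \<in> pairings" "\<chi>' \<in> pairings" "\<chi> x = \<chi>' x" "\<chi> y = \<chi>' y"
  shows "\<chi> = \<chi>'"
proof (rule pairings_eqI[OF X(1,2)])
  fix w assume w: "w \<in> carrier G"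
  obtain f where f: "cocycle G f" "\<And>g. g \<in> carrier G \<Longrightarrow> \<chi> g = pairing f z g"
    using pairingsE[OF X(1)] by metis
  obtain f' where f': "cocycle G f'" "\<And>g. g \<in> carrier G \<Longrightarrow> \<chi>' g = pairing f' z g"
    using pairingsE[OF X(2)] by metis
  have e: "pairing f z w = inverse (pairing f (commutator y w) x * pairing f (commutator w x) y)"
    if f: "cocycle G f" for f
  proof -
    have "pairing f z w * pairing f (commutator y w) x * pairing f (commutator w x) y = 1"
      using hall_witt_pairing[OF f c w K_comm[OF K] K_comm[OF K] K_comm[OF K]] c w
      by (simp add: pairing_K_conjugate[OF f K] z)
    then show ?thesis by (intro inverse_unique[symmetric]) (simp add: mult_ac)
  qed
  have "pairing f (commutator y w) x = pairing f' (commutator y w) x"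
    using X(3) f(2)[OF c(1)] f'(2)[OF c(1)] pairing_cong[OF f(1) f'(1) c(1) K[OF c(2) w]] by simp
  moreover have "pairing f (commutator w x) y = pairing f' (commutator w x) y"
    using X(4) f(2)[OF c(2)] f'(2)[OF c(2)] pairing_cong[OF f(1) f'(1) c(2) K[OF w c(1)]] by simp
  ultimately have "pairing f z w = pairing f' z w" unfolding e[OF f(1)] e[OF f'(1)] by simp
  then show "\<chi> w = \<chi>' w" using f f' w by simp
qed

text \<open>All $\chi \in$ \<open>pairings\<close> are trivial on $K$ and on squares. If some square is outside $K$, this leaves
  at most two of them. Otherwise one of $x^2$, $y^2$, $(xy)^2$ equals $z$, for if all were trivial, $x$ and $y$ would
  commute; and an element commutes with its square in every extension, so that $\chi$ is trivial at $x$,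
  $y$ or $x y$. One value then determines $\chi$.\<close>

lemma card_pairings_order_8:
  assumes p2: "p = 2" and G: "order G = 8"
    and K: "\<And>g h. g \<in> carrier G \<Longrightarrow> h \<in> carrier G \<Longrightarrow> commutator g h \<in> K"
    and z: "z = commutator x y" and c: "x \<in> carrier G" "y \<in> carrier G"
  shows "card pairings \<le> 2"
proof (cases "\<forall>g\<in>carrier G. g \<otimes> g \<in> K")
  case False
  then obtain g where g: "g \<in> carrier G" "g \<otimes> g \<notin> K" by blast
  define S where "S = generate G (insert (g \<otimes> g) K)"
  have sub: "insert (g \<otimes> g) K \<subseteq> carrier G" using g K_closed by auto
  have S: "subgroup S G" unfolding S_def using sub by (rule generate_is_subgroup)
  have G8: "order G = p ^ 3" using G p2 by simp
  have "K \<subset> S" using g unfolding S_def by (auto intro: generate.incl)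
  then have "4 \<le> card S" using card_subgroup_strict[OF prime G8 subgroup_K S] card_K p2 by simp
  moreover have "\<chi> s = 1" if \<chi>: "\<chi> \<in> pairings" and s: "s \<in> S" for \<chi> s
  proof (rule hom_one_on_generate[OF _ _ sub _ s[unfolded S_def]])
    have r: "\<chi> \<in> root_characters p" using \<chi> pairings_root_characters by blast
    show "\<chi> (g \<otimes> h) = \<chi> g * \<chi> h" if "g \<in> carrier G" "h \<in> carrier G" for g h
      using root_characterD(2)[OF r] that by blast
    show "\<chi> g \<noteq> 0" if "g \<in> carrier G" for g
      using root_character_nonzero[OF r] that p2 by simp
    have "\<chi> (g \<otimes> g) = 1" using root_characterD[OF r g(1)] g p2 by (simp add: power2_eq_square)
    then show "\<chi> t = 1" if "t \<in> insert (g \<otimes> g) K" for t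
      using that pairings_trivial_on_K[OF \<chi>] by auto
  qed
  then have "card pairings * card S \<le> 8"
    using card_root_characters_trivial_on[OF prime G8 pairings_root_characters S] G by simp
  ultimately have "card pairings * 4 \<le> 8" by (meson le_trans mult_le_mono2)
  then show ?thesis by simp
next
  case True
  have two: "k = \<one> \<or> k = z" if k: "k \<in> K" for k
  proof -
    obtain i :: nat where i: "k = z [^] i" using k by (auto simp: K_def)
    have "i mod 2 = 0 \<or> i mod 2 = 1" by auto
    then have "z [^] i = z [^] (0::nat) \<or> z [^] i = z [^] (1::nat)" unfolding z_pow_eq_iff p2 by auto
    then show ?thesis using i by simp
  qed
  have sq: "\<chi> g = 1" if \<chi>: "\<chi> \<in> pairings" and g: "g \<in> carrier G" "g \<otimes> g = z" for \<chi> g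
  proof -
    obtain f where f: "cocycle G f" "\<And>g. g \<in> carrier G \<Longrightarrow> \<chi> g = pairing f z g"
      using pairingsE[OF \<chi>] by metis
    have "f (g \<otimes> g, g) = f (g, g \<otimes> g)"
      using cocycleD[OF f(1) g(1) g(1)] g(1) by (metis mult_cancel_left)
    then show ?thesis using f(2)[OF g(1)] g cocycleD(1)[OF f(1) g(1) z_closed]
      by (simp add: pairing_def)
  qed
  have det: "\<chi> = \<chi>'" if "\<chi> \<in> pairings" "\<chi>' \<in> pairings" "\<chi> x = \<chi>' x" "\<chi> y = \<chi>' y" for \<chi> \<chi>'
    by (rule pairings_determined_class2[OF _ z c that]) (rule K)
  have nontriv: "x \<otimes> x = z \<or> y \<otimes> y = z \<or> (x \<otimes> y) \<otimes> (x \<otimes> y) = z"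
  proof (rule ccontr)
    assume "\<not> ?thesis"
    then have e: "x \<otimes> x = \<one>" "y \<otimes> y = \<one>" "(x \<otimes> y) \<otimes> (x \<otimes> y) = \<one>"
      using two True c by (metis m_closed)+
    have "inv x = x" "inv y = y" "inv (x \<otimes> y) = x \<otimes> y"
      using e c by (auto intro!: inv_equality)
    then have "x \<otimes> y = y \<otimes> x" using c by (metis inv_mult_group)
    then have "z = \<one>" using c commutator_eq_one_iff by (simp add: z)
    then show False using z_ne by simp
  qed
  have "p > 0" using p2 by simp
  have "\<exists>b\<in>carrier G. \<forall>\<chi>\<in>pairings. \<forall>\<chi>'\<in>pairings. \<chi> b = \<chi>' b \<longrightarrow> \<chi> = \<chi>'"
    using nontriv
  proof (elim disjE)
    assume xx: "x \<otimes> x = z"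
    have "\<chi> = \<chi>'" if "\<chi> \<in> pairings" "\<chi>' \<in> pairings" "\<chi> y = \<chi>' y" for \<chi> \<chi>'
      using det[OF that(1,2) _ that(3)] sq[OF that(1) c(1) xx] sq[OF that(2) c(1) xx] by simp
    then show ?thesis using c(2) by blast
  next
    assume yy: "y \<otimes> y = z"
    have "\<chi> = \<chi>'" if "\<chi> \<in> pairings" "\<chi>' \<in> pairings" "\<chi> x = \<chi>' x" for \<chi> \<chi>'
      using det[OF that(1,2,3)] sq[OF that(1) c(2) yy] sq[OF that(2) c(2) yy] by simp
    then show ?thesis using c(1) by blast
  next
    assume xy: "(x \<otimes> y) \<otimes> (x \<otimes> y) = z"
    have inv: "\<chi> y = inverse (\<chi> x)" if \<chi>: "\<chi> \<in> pairings" for \<chi>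
    proof -
      have "\<chi> (x \<otimes> y) = \<chi> x * \<chi> y"
        using pairings_root_characters \<chi> c by (intro root_characterD(2)[of \<chi> p]) auto
      then have "\<chi> x * \<chi> y = 1" using sq[OF \<chi> m_closed[OF c] xy] by simp
      then show ?thesis by (rule inverse_unique[symmetric])
    qed
    have "\<chi> = \<chi>'" if "\<chi> \<in> pairings" "\<chi>' \<in> pairings" "\<chi> x = \<chi>' x" for \<chi> \<chi>'
      using det[OF that(1,2,3)] inv[OF that(1)] inv[OF that(2)] that(3) by simp
    then show ?thesis using c(1) by blast
  qed
  then show ?thesis
    using card_root_characters_le[OF \<open>p > 0\<close> pairings_root_characters] unfolding p2 by blast
qed

end

section \<open>Restrictions on the pairing in class three\<close>

text \<open>The situation $\gamma_3(G) \le K$, in which triple commutators are central of order dividing $p$.\<close>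

locale class3_central_prime = central_prime +
  assumes triple: "\<And>a b g. a \<in> carrier G \<Longrightarrow> b \<in> carrier G \<Longrightarrow> g \<in> carrier G \<Longrightarrow>
    commutator (commutator a b) g \<in> K"
begin

lemma triple_mult_right:
  assumes "a \<in> carrier G" "b \<in> carrier G" "g \<in> carrier G" "h \<in> carrier G"
  shows "commutator (commutator a b) (g \<otimes> h) = commutator (commutator a b) g \<otimes> commutator (commutator a b) h"
  using assms conjugate_central[OF K_central[OF triple[OF assms(1,2,4)]] assms(3)]
  by (simp add: commutator_mult_right)

text \<open>For fixed $a, b$ the map $g \mapsto [[a,b],g]$ is a homomorphism to the abelian group $K$.\<close>

lemma triple_commutator:
  assumes c: "a \<in> carrier G" "b \<in> carrier G" "g \<in> carrier G" "h \<in> carrier G"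
  shows "commutator (commutator a b) (commutator g h) = \<one>"
proof -
  let ?t = "commutator (commutator a b)"
  have "?t (commutator g h) \<otimes> ?t (h \<otimes> g) = ?t (commutator g h \<otimes> (h \<otimes> g))"
    using triple_mult_right[OF c(1,2), of "commutator g h" "h \<otimes> g"] c by simp
  also have "commutator g h \<otimes> (h \<otimes> g) = g \<otimes> h" using c by (simp add: word_simps)
  also have "?t (g \<otimes> h) = ?t (h \<otimes> g)"
    using triple_mult_right[OF c(1,2,3,4)] triple_mult_right[OF c(1,2,4,3)]
      K_comm[OF triple[OF c(1,2,3)], of "?t h"] c by simp
  finally have "?t (commutator g h) \<otimes> ?t (h \<otimes> g) = ?t (h \<otimes> g)" .
  then show ?thesis using r_cancel_one[of "?t (h \<otimes> g)" "?t (commutator g h)"] c by simp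
qed

lemma commutators_commute:
  assumes c: "a \<in> carrier G" "b \<in> carrier G" "g \<in> carrier G" "h \<in> carrier G"
  shows "commutator a b \<otimes> commutator g h = commutator g h \<otimes> commutator a b"
  using triple_commutator[OF c] c by (simp add: commutator_eq_one_iff)

lemma triple_swap:
  assumes c: "a \<in> carrier G" "b \<in> carrier G" "g \<in> carrier G"
  shows "commutator (commutator b a) g = inv (commutator (commutator a b) g)"
proof -
  let ?c = "commutator a b"
  have i: "commutator b a = inv ?c" using c by (simp add: inv_commutator)
  have "commutator (?c \<otimes> inv ?c) g = conjugate ?c (commutator (inv ?c) g) \<otimes> commutator ?c g"
    using c by (intro commutator_mult_left) auto
  also have "conjugate ?c (commutator (inv ?c) g) = commutator (inv ?c) g"
    using conjugate_central[OF K_central[OF triple[of b a g]]] c by (simp add: i)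
  finally have "commutator (inv ?c) g \<otimes> commutator ?c g = \<one>"
    using c commutator_central_left[OF central_one] by simp
  then show ?thesis using c by (simp add: i inv_equality[symmetric])
qed

lemma conjugate_commutator:
  assumes c: "a \<in> carrier G" "b \<in> carrier G" "g \<in> carrier G"
  obtains k where "k \<in> K" "conjugate g (commutator a b) = k \<otimes> commutator a b"
proof (rule that)
  show "commutator g (commutator a b) \<in> K"
    using K_inv[OF triple[OF c]] inv_commutator[of "commutator a b" g] c by simp
  show "conjugate g (commutator a b) = commutator g (commutator a b) \<otimes> commutator a b"
    using c by (intro conjugate_eq_commutator_mult) auto
qed

lemma triple_mult_middle:
  assumes c: "a \<in> carrier G" "b \<in> carrier G" "g \<in> carrier G" "h \<in> carrier G"
  shows "commutator (commutator a (b \<otimes> g)) h = commutator (commutator a b) h \<otimes> commutator (commutator a g) h"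
proof -
  obtain k where k: "k \<in> K" "conjugate b (commutator a g) = k \<otimes> commutator a g"
    using conjugate_commutator[OF c(1,3,2)] by blast
  note kc = K_closed[OF k(1)]
  have t: "central (commutator (commutator a g) h)" "central (commutator (commutator a b) h)"
    using K_central[OF triple] c by blast+
  have "commutator (k \<otimes> commutator a g) h = commutator (commutator a g) h"
    using commutator_mult_left[OF kc, of "commutator a g" h] c conjugate_central[OF t(1) kc]
      commutator_central_left[OF K_central[OF k(1)] c(4)] by simp
  moreover have "commutator (commutator a b \<otimes> (k \<otimes> commutator a g)) h
      = conjugate (commutator a b) (commutator (k \<otimes> commutator a g) h) \<otimes> commutator (commutator a b) h"
    using c kc by (intro commutator_mult_left) auto
  ultimately have "commutator (commutator a (b \<otimes> g)) h
      = commutator (commutator a g) h \<otimes> commutator (commutator a b) h"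
    using c k(2) conjugate_central[OF t(1), of "commutator a b"] by (simp add: commutator_mult_right)
  then show ?thesis using c centralD(2)[OF t(1)] by simp
qed

lemma jacobi:
  assumes c: "x \<in> carrier G" "y \<in> carrier G" "w \<in> carrier G"
  shows "commutator (commutator x y) w \<otimes> commutator (commutator y w) x \<otimes> commutator (commutator w x) y = \<one>"
proof -
  have "commutator (commutator a b) (conjugate d g) = commutator (commutator a b) g"
    if "a \<in> carrier G" "b \<in> carrier G" "d \<in> carrier G" "g \<in> carrier G" for a b d g
    using triple_mult_right[OF that(1,2), of "commutator d g" g] triple_commutator[OF that] that
    by (simp add: conjugate_eq_commutator_mult)
  then show ?thesis using hall_witt[OF c] c by simp
qed

text \<open>The trilinear map $[[a,b],g]$ would be alternating in all variables, so that the three terms of the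
  Jacobi identity coincide; $3$ is invertible modulo $p$.\<close>

lemma engel_imp_triple_trivial:
  assumes engel: "\<And>a b. a \<in> carrier G \<Longrightarrow> b \<in> carrier G \<Longrightarrow> commutator (commutator a b) b = \<one>"
    and p3: "p \<noteq> 3" and c: "x \<in> carrier G" "y \<in> carrier G" "w \<in> carrier G"
  shows "commutator (commutator x y) w = \<one>"
proof -
  let ?t = "\<lambda>a b g. commutator (commutator a b) g"
  have alt: "?t a g b = inv (?t a b g)" if c: "a \<in> carrier G" "b \<in> carrier G" "g \<in> carrier G" for a b g
  proof -
    \<comment> \<open>Linearisation of the Engel condition.\<close>
    have "?t a (b \<otimes> g) (b \<otimes> g) = (?t a b b \<otimes> ?t a g b) \<otimes> (?t a b g \<otimes> ?t a g g)"
      using c by (simp add: triple_mult_right triple_mult_middle)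
    then have "?t a g b \<otimes> ?t a b g = \<one>" using engel c by simp
    then show ?thesis using c by (intro inv_equality[symmetric]) auto
  qed
  have "?t y w x = ?t x y w"
    using alt[OF c(2,1,3)] triple_swap[OF c] c by simp
  moreover have "?t w x y = ?t x y w"
    using triple_swap[OF c(1,3,2)] alt[OF c] c by simp
  ultimately have "?t x y w \<otimes> ?t x y w \<otimes> ?t x y w = \<one>" using jacobi[OF c] by simp
  then have three: "?t x y w [^] (3::nat) = \<one>" using c by (simp add: numeral_3_eq_3)
  obtain i :: nat where i: "?t x y w = z [^] i" using triple[OF c] by (auto simp: K_def)
  have "z [^] (i * 3) = z [^] (0::nat)" using three by (simp add: i nat_pow_pow)
  then have "p dvd i * 3" unfolding z_pow_eq_iff by (simp add: mod_eq_0_iff_dvd)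
  moreover have "\<not> p dvd 3"
  proof
    assume "p dvd 3"
    then have "p \<le> 3" by (rule dvd_imp_le) simp
    then have "p = 2" using p3 p_gt_1 by simp
    then show False using \<open>p dvd 3\<close> by simp
  qed
  ultimately have "p dvd i" using prime prime_dvd_mult_nat by blast
  then have "z [^] i = z [^] (0::nat)" unfolding z_pow_eq_iff by simp
  then show ?thesis by (simp add: i)
qed

text \<open>The conjugate differs from the commutator by an element of $K$, whose pairing with commutators is trivial.\<close>

lemma pairing_commutator_conjugate:
  assumes f: "cocycle G f" and c: "a \<in> carrier G" "b \<in> carrier G" "g \<in> carrier G" "h \<in> carrier G" "w \<in> carrier G"
  shows "pairing f (commutator a b) (conjugate w (commutator g h)) = pairing f (commutator a b) (commutator g h)"
    and "commutator a b \<otimes> conjugate w (commutator g h) = conjugate w (commutator g h) \<otimes> commutator a b"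
proof -
  let ?d = "commutator a b" and ?c = "commutator g h"
  obtain k where k: "k \<in> K" "conjugate w ?c = k \<otimes> ?c"
    using conjugate_commutator[OF c(3,4,5)] by blast
  note kc = K_closed[OF k(1)]
  have dk: "?d \<otimes> k = k \<otimes> ?d" using K_comm[OF k(1)] c by simp
  have dc: "?d \<otimes> ?c = ?c \<otimes> ?d" using commutators_commute c by blast
  have "pairing f ?d k = 1"
    using pairing_K_commutator[OF f k(1) c(1,2)] inverse_pairing[of f k ?d] by simp
  then show "pairing f ?d (conjugate w ?c) = pairing f ?d ?c"
    using pairing_mult_right[OF f _ kc _ dk dc] c by (simp add: k(2))
  have "?d \<otimes> (k \<otimes> ?c) = k \<otimes> (?d \<otimes> ?c)" using dk c kc by (metis commutator_closed m_assoc)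
  also have "\<dots> = k \<otimes> ?c \<otimes> ?d" using c kc by (simp add: dc m_assoc)
  finally show "?d \<otimes> conjugate w ?c = conjugate w ?c \<otimes> ?d" by (simp add: k(2))
qed

text \<open>Hall-Witt for $[a,b], g, h$. The middle term pairs two commutators and has no counterpart in $G$; it is
  eliminated by exchanging the roles of $a, b$ and $g, h$.\<close>

lemma pairing_three_term:
  assumes f: "cocycle G f" and c: "a \<in> carrier G" "b \<in> carrier G" "g \<in> carrier G" "h \<in> carrier G"
  shows "pairing f (commutator (commutator a b) g) h * pairing f (commutator g h) (commutator a b)
    * pairing f (commutator h (commutator a b)) g = 1"
proof -
  let ?c = "commutator a b"
  have cc: "?c \<in> carrier G" using c by simp
  have K3: "commutator h ?c \<in> K" using K_inv[OF triple[OF c(1,2,4)]] inv_commutator[OF cc c(4)] by simp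
  note K1 = triple[OF c(1,2,3)]
  have "pairing f (commutator ?c g) (conjugate g h) * pairing f (commutator g h) (conjugate h ?c)
    * pairing f (commutator h ?c) (conjugate ?c g) = 1"
    using c by (intro hall_witt_pairing[OF f cc c(3,4)] K_comm K1 K3
        pairing_commutator_conjugate(2)[OF f]) auto
  then show ?thesis
    using c cc by (simp add: pairing_K_conjugate[OF f K1] pairing_K_conjugate[OF f K3]
        pairing_commutator_conjugate(1)[OF f])
qed

lemma pairing_four_term:
  assumes f: "cocycle G f" and c: "a \<in> carrier G" "b \<in> carrier G" "g \<in> carrier G" "h \<in> carrier G"
  shows "pairing f (commutator (commutator a b) g) h * pairing f (commutator h (commutator a b)) g
    * pairing f (commutator (commutator g h) a) b * pairing f (commutator b (commutator g h)) a = 1"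
proof -
  have "pairing f (commutator g h) (commutator a b) * pairing f (commutator a b) (commutator g h) = 1"
    using pairing_nonzero[OF f, of "commutator a b" "commutator g h"] c
    by (simp flip: inverse_pairing[of f "commutator a b" "commutator g h"])
  moreover have "(pairing f (commutator (commutator a b) g) h * pairing f (commutator g h) (commutator a b)
      * pairing f (commutator h (commutator a b)) g)
    * (pairing f (commutator (commutator g h) a) b * pairing f (commutator a b) (commutator g h)
      * pairing f (commutator b (commutator g h)) a) = 1"
    unfolding pairing_three_term[OF f c] pairing_three_term[OF f c(3,4,1,2)] by simp
  then have "(pairing f (commutator g h) (commutator a b) * pairing f (commutator a b) (commutator g h))
    * (pairing f (commutator (commutator a b) g) h * pairing f (commutator h (commutator a b)) g
    * pairing f (commutator (commutator g h) a) b * pairing f (commutator b (commutator g h)) a) = 1"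
    by (simp only: mult_ac)
  ultimately show ?thesis by simp
qed

text \<open>The four-term relation at $(a, b, b, y)$: its first factor is the value at $y$, the others are values of
  the pairing with elements of $K$ at $a$ and $b$.\<close>

lemma pairings_determined_class3:
  assumes z: "z = commutator (commutator a b) b" and c: "a \<in> carrier G" "b \<in> carrier G"
    and X: "\<chi> \<in> pairings" "\<chi>' \<in> pairings" "\<chi> a = \<chi>' a" "\<chi> b = \<chi>' b"
  shows "\<chi> = \<chi>'"
proof (rule pairings_eqI[OF X(1,2)])
  fix y assume y: "y \<in> carrier G"
  let ?c = "commutator a b" and ?d = "commutator b y"
  obtain f where f: "cocycle G f" "\<And>g. g \<in> carrier G \<Longrightarrow> \<chi> g = pairing f z g"
    using pairingsE[OF X(1)] by metis
  obtain f' where f': "cocycle G f'" "\<And>g. g \<in> carrier G \<Longrightarrow> \<chi>' g = pairing f' z g"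
    using pairingsE[OF X(2)] by metis
  have K: "commutator y ?c \<in> K" "commutator ?d a \<in> K" "commutator b ?d \<in> K"
    using K_inv[OF triple[OF c y]] K_inv[OF triple[OF c(2) y c(2)]] triple[OF c(2) y c(1)] c y
    by (simp_all add: inv_commutator)
  have a: "pairing f k a = pairing f' k a" and b: "pairing f k b = pairing f' k b" if "k \<in> K" for k
    using pairing_cong[OF f(1) f'(1) c(1) that] pairing_cong[OF f(1) f'(1) c(2) that]
      X(3,4) f(2) f'(2) c by simp_all
  have e: "pairing f z y = inverse (pairing f (commutator y ?c) b * pairing f (commutator ?d a) b
      * pairing f (commutator b ?d) a)" if "cocycle G f" for f
    using pairing_four_term[OF that c(1,2) c(2) y]
    by (intro inverse_unique[symmetric]) (simp add: z mult_ac)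
  have "pairing f z y = pairing f' z y" unfolding e[OF f(1)] e[OF f'(1)] by (simp add: a b K)
  then show "\<chi> y = \<chi>' y" using f f' y by simp
qed

text \<open>At $y = a$ the same relation reads $\chi(a)^2 \psi(b)^2 = 1$, where $\psi$ is the pairing with
  $[a,[a,b]] \in K$. It determines $\chi(a)$ because squaring is injective on $p$-th roots of unity for odd $p$.\<close>

lemma pairings_determined_class3_odd:
  assumes z: "z = commutator (commutator a b) b" and c: "a \<in> carrier G" "b \<in> carrier G"
    and odd: "odd p" and X: "\<chi> \<in> pairings" "\<chi>' \<in> pairings" "\<chi> b = \<chi>' b"
  shows "\<chi> = \<chi>'"
proof -
  let ?c = "commutator a b"
  obtain f where f: "cocycle G f" "\<And>g. g \<in> carrier G \<Longrightarrow> \<chi> g = pairing f z g"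
    using pairingsE[OF X(1)] by metis
  obtain f' where f': "cocycle G f'" "\<And>g. g \<in> carrier G \<Longrightarrow> \<chi>' g = pairing f' z g"
    using pairingsE[OF X(2)] by metis
  have K: "commutator a ?c \<in> K"
    using K_inv[OF triple[OF c c(1)]] inv_commutator[of ?c a] c by simp
  have i: "commutator (commutator b a) a = commutator a ?c" "commutator b (commutator b a) = z"
    using triple_swap[OF c c(1)] triple_swap[OF c c(2)] inv_commutator[of ?c a]
      inv_commutator[of "commutator b a" b] c z by (simp_all add: inv_commutator)
  have e: "pairing f z a ^ 2 = inverse (pairing f (commutator a ?c) b ^ 2)" if "cocycle G f" for f
    using pairing_four_term[OF that c(1,2) c(2,1)]
    by (intro inverse_unique[symmetric]) (simp add: i flip: z, simp add: power2_eq_square mult_ac)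
  have "pairing f (commutator a ?c) b = pairing f' (commutator a ?c) b"
    using pairing_cong[OF f(1) f'(1) c(2) K] X(3) f(2) f'(2) c by simp
  then have "pairing f z a ^ 2 = pairing f' z a ^ 2" unfolding e[OF f(1)] e[OF f'(1)] by simp
  then have sq: "\<chi> a ^ 2 = \<chi>' a ^ 2" using f(2) f'(2) c by simp
  obtain m where m: "p = 2 * m + 1" using odd oddE by blast
  \<comment> \<open>Raising to the power $m + 1$ inverts squaring, since $2 (m + 1) = p + 1$.\<close>
  have pow: "\<psi> a = (\<psi> a ^ 2) ^ (m + 1)" if "\<psi> \<in> pairings" for \<psi>
  proof -
    have "\<psi> a ^ p = 1" using that pairings_root_characters root_characterD(1) c by blast
    then have "\<psi> a = \<psi> a ^ (p + 1)" by simp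
    also have "p + 1 = 2 * (m + 1)" by (simp add: m)
    finally show ?thesis by (simp only: power_mult)
  qed
  have "\<chi> a = \<chi>' a" using pow[OF X(1)] pow[OF X(2)] sq by simp
  then show ?thesis by (rule pairings_determined_class3[OF z c X(1,2) _ X(3)])
qed

end

section \<open>Bounds for the Schur multiplier\<close>

lemma choose_two_Suc: "Suc j choose 2 = (j choose 2) + j"
  by (simp add: numeral_2_eq_2)

lemma trivial_schur_multiplier:
  fixes G :: "('a, 'b) monoid_scheme" (structure)
  assumes "group G" "order G = 1" shows "order (schur_multiplier G) \<le> 1"
proof -
  interpret group G by fact
  have G: "carrier G = {\<one>}"
    using assms(2) one_closed by (metis order_def card_1_singletonE singletonD)
  obtain R where R: "finite R" "card R = order (schur_multiplier G)"
    "\<And>r. r \<in> R \<Longrightarrow> cocycle G r"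
    "\<And>r r'. r \<in> R \<Longrightarrow> r' \<in> R \<Longrightarrow> cohomologous G r r' \<Longrightarrow> r = r'"
    using cohomology_transversal[of thesis] G by (metis finite.emptyI finite.insertI)
  have "cohomologous G r r'" if "r \<in> R" "r' \<in> R" for r r'
    using cocycleD(1)[OF R(3)[OF that(1)], of \<one> \<one>] cocycleD(1)[OF R(3)[OF that(2)], of \<one> \<one>]
    unfolding cohomologous_def is_coboundary_def
    by (intro exI[of _ "\<lambda>_. r (\<one>, \<one>) / r' (\<one>, \<one>)"]) (simp add: G)
  then have "r = r'" if "r \<in> R" "r' \<in> R" for r r' using R(4) that by blast
  then have "card R \<le> 1" using card_le_Suc0_iff_eq[OF R(1)] by simp
  then show ?thesis by (simp add: R(2))
qed

text \<open>Passing from order $p^n$ to $p^{n+1}$ costs at most a factor $p^n$, since the pairings are trivial on $K$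
  and hence are characters of a group of order $p^n$.\<close>

lemma schur_multiplier_abelian_bound:
  fixes G :: "'a monoid"
  assumes p: "prime p"
  shows "group G \<Longrightarrow> \<forall>x\<in>carrier G. \<forall>y\<in>carrier G. x \<otimes>\<^bsub>G\<^esub> y = y \<otimes>\<^bsub>G\<^esub> x \<Longrightarrow> order G = p ^ n \<Longrightarrow>
    order (schur_multiplier G) \<le> p ^ (n choose 2)"
proof (induction n arbitrary: G)
  case 0
  then show ?case using trivial_schur_multiplier[of G] by (simp add: binomial_eq_0)
next
  case (Suc n)
  interpret group G by fact
  have p1: "p > 1" using p prime_gt_1_nat by blast
  have fin: "finite (carrier G)" using Suc.prems(3) p1 order_gt_0_iff_finite by simp
  have "carrier G \<noteq> {\<one>\<^bsub>G\<^esub>}"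
  proof
    assume "carrier G = {\<one>\<^bsub>G\<^esub>}"
    then have "p ^ Suc n = 1" using Suc.prems(3) by (simp add: order_def)
    then show False using p1 by simp
  qed
  then obtain x where x: "x \<in> carrier G" "x \<noteq> \<one>\<^bsub>G\<^esub>" using one_closed by blast
  have "central x" using x Suc.prems(2) by (simp add: central_def)
  then obtain z where "central_prime G p z"
    using exists_central_prime[OF p Suc.prems(3) x(1) subgroup_self _ x(2)] by blast
  then interpret central_prime G p z .
  have "order Q = p ^ n" using order_Q Suc.prems(3) p1 by simp
  moreover have "\<forall>x\<in>carrier Q. \<forall>y\<in>carrier Q. x \<otimes>\<^bsub>Q\<^esub> y = y \<otimes>\<^bsub>Q\<^esub> x"
    using QD(1) Suc.prems(2) by (simp add: Q_simps(2))
  ultimately have IH: "order (schur_multiplier Q) \<le> p ^ (n choose 2)" using Suc.IH group_Q by blast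
  have "card pairings * p \<le> p ^ n * p" using card_pairings_K[OF Suc.prems(3)] Suc.prems(3) by (simp add: mult.commute)
  then have "card pairings \<le> p ^ n" using p1 by simp
  then have "order (schur_multiplier G) \<le> p ^ (n choose 2) * p ^ n"
    using order_schur_multiplier_le_quotient[OF fin] IH by (meson le_trans mult_le_mono)
  then show ?case by (simp add: choose_two_Suc power_add)
qed

lemma (in group) commutator_in_lower_central_1:
  "x \<in> carrier G \<Longrightarrow> y \<in> carrier G \<Longrightarrow> commutator x y \<in> lower_central G 1"
  using commutator_in_lower_central[of x 0 y] by simp

lemma (in group) exists_noncentral_commutator:
  assumes "lower_central G (Suc (Suc i)) \<noteq> {\<one>}"
  obtains x y where "x \<in> lower_central G i" "y \<in> carrier G" "\<not> central (commutator x y)"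
proof -
  have "\<exists>x\<in>lower_central G i. \<exists>y\<in>carrier G. \<not> central (commutator x y)"
  proof (rule ccontr)
    assume all: "\<not> ?thesis"
    have "central x" if "x \<in> lower_central G (Suc i)" for x
      using that unfolding lower_central_Suc
    proof induction
      case (inv h) then show ?case using all by (auto intro: central_inv)
    next
      case (eng a b) then show ?case by (intro central_mult)
    qed (use all in auto)
    then show False using assms lower_central_Suc_trivial_iff by blast
  qed
  then show thesis using that by blast
qed

lemma (in group) order_pos_finite:
  "order G = p ^ n \<Longrightarrow> prime p \<Longrightarrow> finite (carrier G)"
  using order_gt_0_iff_finite prime_gt_0_nat by simp

text \<open>The data of a quotient by a central subgroup of the commutator subgroup, in the form used by the
  inductions on $k$; the rank parameter $m$ does not change.\<close>

lemma central_prime_step: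
  fixes G :: "'a monoid"
  assumes z: "central_prime G p z" "z \<in> lower_central G 1" and nil: "lower_central G c = {\<one>\<^bsub>G\<^esub>}"
    and ord: "order G = p ^ (m + Suc k)" and der: "card (lower_central G 1) = p ^ Suc k"
  shows "group (central_prime.Q G z)" "lower_central (central_prime.Q G z) c = {\<one>\<^bsub>central_prime.Q G z\<^esub>}"
    "order (central_prime.Q G z) = p ^ (m + k)" "card (lower_central (central_prime.Q G z) 1) = p ^ k"
    "card (central_prime.pairings G z) \<le> p ^ m"
    "order (schur_multiplier G) * p \<le> order (schur_multiplier (central_prime.Q G z)) * card (central_prime.pairings G z)"
proof -
  interpret central_prime G p z by fact
  note p1 = p_gt_1
  have der1: "derived G (carrier G) = lower_central G 1" by (simp only: One_nat_def lower_central_1)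
  have fin: "finite (carrier G)" using order_pos_finite[OF ord prime] .
  show "group Q" by (rule group_Q)
  show "lower_central Q c = {\<one>\<^bsub>Q\<^esub>}" using nilpotent_Q[OF nil] .
  show "order Q = p ^ (m + k)" using order_Q ord p1 by simp
  show "card (lower_central Q 1) = p ^ k" using card_lower_central_Q[OF z(2)] der p1 by simp
  have "card pairings * p ^ Suc k \<le> p ^ m * p ^ Suc k"
    using card_pairings_derived[OF ord] ord der by (simp only: der1 power_add)
  then show "card pairings \<le> p ^ m" using p1 by simp
  show "order (schur_multiplier G) * p \<le> order (schur_multiplier Q) * card pairings"
    using order_schur_multiplier_le_quotient_derived[OF fin] z(2) der1 by simp
qed

text \<open>A commutator subgroup of prime order is central, because it meets the centre nontrivially, and is
  generated by any nontrivial commutator.\<close>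

lemma derived_prime_order:
  fixes G :: "'a monoid" (structure)
  assumes p: "prime p" and G: "group G" and nil: "lower_central G c = {\<one>\<^bsub>G\<^esub>}"
    and ord: "order G = p ^ n" and der: "card (lower_central G 1) = p"
  obtains x y where "x \<in> carrier G" "y \<in> carrier G" "central_prime G p (group.commutator G x y)"
    "central_prime.K G (group.commutator G x y) = lower_central G 1"
proof -
  interpret group G by fact
  have p1: "p > 1" using p prime_gt_1_nat by blast
  have fin: "finite (carrier G)" using order_pos_finite[OF ord p] .
  have D: "subgroup (lower_central G 1) G" by (rule lower_central_subgroup)
  have ne: "lower_central G 1 \<noteq> {\<one>}" using der p1 by auto
  obtain x where x: "x \<in> lower_central G 1" "central x" "x \<noteq> \<one>"
    using exists_central_in_lower_central[OF nil ne] by blast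
  obtain z where z: "z \<in> lower_central G 1" "central_prime G p z"
    using exists_central_prime[OF p ord x(1) D x(2,3)] by blast
  interpret z: central_prime G p z by fact
  have KD: "z.K = lower_central G 1"
  proof (rule card_subset_eq)
    show "finite (lower_central G 1)" using finite_subset[OF _ fin] lower_central_closed by blast
    show "z.K \<subseteq> lower_central G 1" using z.K_subset_subgroup[OF D z(1)] .
  qed (simp only: z.card_K der)
  have "\<not> (\<forall>x\<in>lower_central G 0. central x)" using lower_central_Suc_trivial_iff[of 0] ne by simp
  then obtain x y where xy: "x \<in> carrier G" "y \<in> carrier G" "commutator x y \<noteq> \<one>"
    by (auto simp: central_def commutator_eq_one_iff)
  have k: "commutator x y \<in> z.K" using commutator_in_lower_central_1 xy KD by simp
  show thesis
    using that[OF xy(1,2) z.central_prime_of_K[OF k xy(3)]] z.K_of_K[OF k xy(3)] KD by simp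
qed

lemma (in group) commutative_if_derived_trivial:
  assumes "lower_central G 1 = {\<one>}" "x \<in> carrier G" "y \<in> carrier G"
  shows "x \<otimes> y = y \<otimes> x"
  using lower_central_Suc_trivial_iff[of 0] assms centralD(2) by simp

text \<open>The centraliser of $x$ lies strictly between $K$ and $G$: it contains $x$, which is not central, but not $y$.\<close>

lemma (in central_prime) abelianization_rank_ge_2:
  assumes ord: "order G = p ^ (m + 1)" and z: "z = commutator x y" and c: "x \<in> carrier G" "y \<in> carrier G"
  shows "2 \<le> m"
proof -
  define C where "C = {g \<in> carrier G. x \<otimes> g = g \<otimes> x}"
  have C: "subgroup C G" unfolding C_def using subgroup_centralizer[OF c(1)] .
  have nc: "x \<otimes> y \<noteq> y \<otimes> x" using z_ne commutator_eq_one_iff[OF c] z by simp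
  have "K \<subseteq> C" using K_closed K_comm[OF _ c(1), symmetric] by (auto simp: C_def)
  moreover have "x \<in> C" using c by (simp add: C_def)
  moreover have "x \<notin> K" using K_comm[OF _ c(2)] nc by blast
  ultimately have "K \<subset> C" by blast
  then have 1: "p * p \<le> card C" using card_subgroup_strict[OF prime ord subgroup_K C] card_K by simp
  have "y \<notin> C" using nc by (simp add: C_def)
  then have "C \<subset> carrier G" using c by (auto simp: C_def)
  then have "p * card C \<le> card (carrier G)" by (rule card_subgroup_strict[OF prime ord C subgroup_self])
  then have 2: "p * card C \<le> p ^ (m + 1)" using ord by (simp add: order_def)
  have "p * (p * p) \<le> p ^ (m + 1)" using mult_le_mono2[OF 1, of p] 2 by (rule le_trans)
  then have "p ^ 3 \<le> p ^ (m + 1)" by (simp add: power3_eq_cube mult.assoc)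
  then have "3 \<le> m + 1" using p_gt_1 by (simp only: power_increasing_iff)
  then show ?thesis by simp
qed

text \<open>For $|G'| = p$ the two values that determine a pairing leave $p^2$ possibilities; a factor $p$ is returned
  by the transgressions, and $\binom{m}{2} = \binom{m-1}{2} + (m - 1)$. Every further step costs $p^{m-1}$.\<close>

lemma schur_multiplier_nonabelian_bound:
  fixes G :: "'a monoid"
  assumes p: "prime p"
  shows "group G \<Longrightarrow> lower_central G c = {\<one>\<^bsub>G\<^esub>} \<Longrightarrow> order G = p ^ (m + Suc k) \<Longrightarrow>
    card (lower_central G 1) = p ^ Suc k \<Longrightarrow>
    2 \<le> m \<and> order (schur_multiplier G) \<le> p ^ ((m - 1 choose 2) + Suc k * (m - 1) + 1)"
proof (induction k arbitrary: G)
  case 0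
  have p1: "p > 1" using p prime_gt_1_nat by blast
  have der: "card (lower_central G 1) = p" using 0 by simp
  obtain x y where xy: "x \<in> carrier G" "y \<in> carrier G" and cp: "central_prime G p (group.commutator G x y)"
    and KD: "central_prime.K G (group.commutator G x y) = lower_central G 1"
    using derived_prime_order[OF p 0(1,2,3) der] by blast
  define z where "z = group.commutator G x y"
  interpret central_prime G p z using cp by (simp add: z_def)
  have KD: "K = lower_central G 1" using KD by (simp add: z_def)
  note step = central_prime_step[OF central_prime_axioms _ 0(2,3,4)]
  have zD: "z \<in> lower_central G 1" using z_in_K KD by simp
  have comm: "commutator g h \<in> K" if "g \<in> carrier G" "h \<in> carrier G" for g h
    using commutator_in_lower_central_1 that KD by simp
  have m: "2 \<le> m" using abelianization_rank_ge_2[OF _ z_def xy] 0(3) by simp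
  then obtain j where j: "m = Suc (Suc j)" by (metis Suc_le_D numeral_2_eq_2 add_2_eq_Suc le_Suc_ex)
  have "p > 0" using p1 by simp
  have "card pairings \<le> p * p"
  proof (rule card_root_characters_le_square[OF \<open>p > 0\<close> pairings_root_characters xy])
    show "\<chi> = \<chi>'" if "\<chi> \<in> pairings" "\<chi>' \<in> pairings" "\<chi> x = \<chi>' x" "\<chi> y = \<chi>' y" for \<chi> \<chi>'
      by (rule pairings_determined_class2[OF _ z_def xy that]) (rule comm)
  qed
  moreover have "order (schur_multiplier Q) \<le> p ^ (m choose 2)"
  proof -
    interpret Q: group Q by (rule group_Q)
    have "lower_central Q 1 = {\<one>\<^bsub>Q\<^esub>}" by (simp only: lower_central_Q_trivial_iff KD order_refl)
    then have "\<forall>x\<in>carrier Q. \<forall>y\<in>carrier Q. x \<otimes>\<^bsub>Q\<^esub> y = y \<otimes>\<^bsub>Q\<^esub> x"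
      using Q.commutative_if_derived_trivial by blast
    then show ?thesis using schur_multiplier_abelian_bound[OF p group_Q] step(3)[OF zD] by simp
  qed
  ultimately have "order (schur_multiplier G) * p \<le> p ^ (m choose 2) * (p * p)"
    using step(6)[OF zD] by (meson le_trans mult_le_mono)
  also have "\<dots> = p ^ ((m - 1 choose 2) + Suc 0 * (m - 1) + 1) * p"
    by (simp add: j choose_two_Suc power_add)
  finally show ?case using m p1 by simp
next
  case (Suc k)
  interpret group G by fact
  have p1: "p > 1" using p prime_gt_1_nat by blast
  have "lower_central G 1 \<noteq> {\<one>\<^bsub>G\<^esub>}"
  proof
    assume "lower_central G 1 = {\<one>\<^bsub>G\<^esub>}"
    then have "p ^ Suc (Suc k) = 1" using Suc.prems(4) by simp
    then show False using p1 by simp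
  qed
  then obtain x where "x \<in> lower_central G 1" "central x" "x \<noteq> \<one>\<^bsub>G\<^esub>"
    using exists_central_in_lower_central[OF Suc.prems(2)] by blast
  then obtain z where z: "z \<in> lower_central G 1" "central_prime G p z"
    using exists_central_prime[OF p Suc.prems(3) _ lower_central_subgroup] by metis
  interpret central_prime G p z by fact
  note step = central_prime_step[OF z(2,1) Suc.prems(2-4)]
  have IH: "2 \<le> m" "order (schur_multiplier Q) \<le> p ^ ((m - 1 choose 2) + Suc k * (m - 1) + 1)"
    using Suc.IH[OF step(1-4)] by blast+
  have "order (schur_multiplier G) * p \<le> p ^ ((m - 1 choose 2) + Suc k * (m - 1) + 1) * p ^ m"
    using step(5,6) IH(2) by (meson le_trans mult_le_mono)
  also have "\<dots> = p ^ ((m - 1 choose 2) + Suc (Suc k) * (m - 1) + 1) * p"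
  proof -
    obtain j where "m = Suc j" using IH(1) by (cases m) auto
    then show ?thesis by (simp add: power_add)
  qed
  finally show ?case using IH(1) p1 by simp
qed

text \<open>The base case is a non-abelian group of order $8$, with at most two pairings instead of four. The general
  bound for non-abelian groups would give $2^{k+2}$ where $|G'| = 2^{k+1}$.\<close>

lemma schur_multiplier_bound_2_rank_2:
  fixes G :: "'a monoid"
  shows "group G \<Longrightarrow> lower_central G c = {\<one>\<^bsub>G\<^esub>} \<Longrightarrow> order G = 2 ^ (2 + Suc k) \<Longrightarrow>
    card (lower_central G 1) = 2 ^ Suc k \<Longrightarrow> order (schur_multiplier G) \<le> 2 ^ Suc k"
proof (induction k arbitrary: G)
  case 0
  have p: "prime (2::nat)" by (rule two_is_prime_nat)
  have der: "card (lower_central G 1) = 2" using 0 by simp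
  obtain x y where xy: "x \<in> carrier G" "y \<in> carrier G" and cp: "central_prime G 2 (group.commutator G x y)"
    and KD: "central_prime.K G (group.commutator G x y) = lower_central G 1"
    using derived_prime_order[OF p 0(1,2,3) der] by blast
  define z where "z = group.commutator G x y"
  interpret central_prime G 2 z using cp by (simp add: z_def)
  have KD: "K = lower_central G 1" using KD by (simp add: z_def)
  note step = central_prime_step[OF central_prime_axioms _ 0(2,3,4)]
  have zD: "z \<in> lower_central G 1" using z_in_K KD by simp
  have comm: "commutator g h \<in> K" if "g \<in> carrier G" "h \<in> carrier G" for g h
    using commutator_in_lower_central_1 that KD by simp
  have "card pairings \<le> 2"
    by (rule card_pairings_order_8[OF refl _ _ z_def xy]) (use 0(3) comm in auto)
  moreover have "order (schur_multiplier Q) \<le> 2 ^ (2 choose 2)"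
  proof -
    interpret Q: group Q by (rule group_Q)
    have "lower_central Q 1 = {\<one>\<^bsub>Q\<^esub>}" by (simp only: lower_central_Q_trivial_iff KD order_refl)
    then have "\<forall>x\<in>carrier Q. \<forall>y\<in>carrier Q. x \<otimes>\<^bsub>Q\<^esub> y = y \<otimes>\<^bsub>Q\<^esub> x"
      using Q.commutative_if_derived_trivial by blast
    then show ?thesis using schur_multiplier_abelian_bound[OF p group_Q, of 2] step(3)[OF zD] by simp
  qed
  ultimately have "order (schur_multiplier G) * 2 \<le> 2 ^ (2 choose 2) * 2"
    using step(6)[OF zD] by (meson le_trans mult_le_mono)
  then show ?case by simp
next
  case (Suc k)
  interpret group G by fact
  have p: "prime (2::nat)" by (rule two_is_prime_nat)
  have "lower_central G 1 \<noteq> {\<one>\<^bsub>G\<^esub>}"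
  proof
    assume "lower_central G 1 = {\<one>\<^bsub>G\<^esub>}"
    then have "2 ^ Suc (Suc k) = (1::nat)" using Suc.prems(4) by simp
    then show False by simp
  qed
  then obtain x where "x \<in> lower_central G 1" "central x" "x \<noteq> \<one>\<^bsub>G\<^esub>"
    using exists_central_in_lower_central[OF Suc.prems(2)] by blast
  then obtain z where z: "z \<in> lower_central G 1" "central_prime G 2 z"
    using exists_central_prime[OF p Suc.prems(3) _ lower_central_subgroup] by metis
  interpret central_prime G 2 z by fact
  note step = central_prime_step[OF z(2,1) Suc.prems(2-4)]
  have "order (schur_multiplier Q) \<le> 2 ^ Suc k" using Suc.IH[OF step(1-4)] .
  then have "order (schur_multiplier G) * 2 \<le> 2 ^ Suc k * 2 ^ 2"
    using step(5,6) by (meson le_trans mult_le_mono)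
  then show ?case by simp
qed

text \<open>A central subgroup $K$ of order $p$ is taken inside $\gamma_3(G)$. As long as $\gamma_3(G)$ is larger than $K$ the
  quotient still has class at least $3$. Otherwise the bound for the non-abelian quotient $G/K$ applies,
  and the factor $p$ by which it is weaker is regained from the restrictions on the pairings.\<close>

lemma schur_multiplier_class_ge_3_bound:
  fixes G :: "'a monoid"
  assumes p: "prime p" "p \<noteq> 3"
  shows "group G \<Longrightarrow> lower_central G c = {\<one>\<^bsub>G\<^esub>} \<Longrightarrow> lower_central G 2 \<noteq> {\<one>\<^bsub>G\<^esub>} \<Longrightarrow> order G = p ^ (m + k) \<Longrightarrow>
    card (lower_central G 1) = p ^ k \<Longrightarrow>
    2 \<le> m \<and> order (schur_multiplier G) \<le> p ^ ((m - 1 choose 2) + k * (m - 1))"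
proof (induction k arbitrary: G)
  case 0
  interpret group G by fact
  have "finite (lower_central G 1)"
    using 0(5) by (metis card.infinite power_0 zero_neq_one)
  then have "lower_central G 1 = {\<one>\<^bsub>G\<^esub>}"
    using 0(5) subgroup.one_closed[OF lower_central_subgroup[of 1]] by (metis card_1_singletonE power_0 singletonD)
  then have "lower_central G 2 = {\<one>\<^bsub>G\<^esub>}"
    using lower_central_Suc_subset[of 1] subgroup.one_closed[OF lower_central_subgroup[of 2]]
    by (auto simp: numeral_2_eq_2 simp del: lower_central.simps)
  then show ?case using 0 by simp
next
  case (Suc k)
  interpret group G by fact
  have p1: "p > 1" using p prime_gt_1_nat by blast
  obtain x where "x \<in> lower_central G 2" "central x" "x \<noteq> \<one>\<^bsub>G\<^esub>"
    using exists_central_in_lower_central[OF Suc.prems(2,3)] by blast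
  then obtain z0 where z0: "z0 \<in> lower_central G 2" "central_prime G p z0"
    using exists_central_prime[OF p(1) Suc.prems(4) _ lower_central_subgroup] by metis
  interpret z0: central_prime G p z0 by fact
  have sub21: "lower_central G 2 \<subseteq> lower_central G 1" by (rule lower_central_antimono) simp
  note step0 = central_prime_step[OF z0(2) subsetD[OF sub21 z0(1)] Suc.prems(2,4,5)]
  have rank: "2 \<le> m" using schur_multiplier_nonabelian_bound[OF p(1) Suc.prems(1,2,4,5)] by blast
  have exponent: "p ^ ((m - 1 choose 2) + k * (m - 1)) * p ^ m = p ^ ((m - 1 choose 2) + Suc k * (m - 1)) * p"
  proof -
    obtain j where "m = Suc j" using rank by (cases m) auto
    then show ?thesis by (simp add: power_add)
  qed
  show ?case
  proof (cases "lower_central G 2 \<subseteq> z0.K")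
    case False
    then have "lower_central z0.Q 2 \<noteq> {\<one>\<^bsub>z0.Q\<^esub>}" by (simp add: z0.lower_central_Q_trivial_iff)
    then have "order (schur_multiplier z0.Q) \<le> p ^ ((m - 1 choose 2) + k * (m - 1))"
      using Suc.IH[OF step0(1,2) _ step0(3,4)] by blast
    then have "order (schur_multiplier G) * p \<le> p ^ ((m - 1 choose 2) + k * (m - 1)) * p ^ m"
      using step0(5,6) by (meson le_trans mult_le_mono)
    then show ?thesis using rank p1 unfolding exponent by simp
  next
    case True
    then interpret z0: class3_central_prime G p z0
      using commutator_in_lower_central[of _ 1] commutator_in_lower_central_1
      by unfold_locales (auto simp: numeral_2_eq_2 simp del: lower_central.simps)
    have "lower_central G (Suc (Suc 0)) \<noteq> {\<one>\<^bsub>G\<^esub>}" using Suc.prems(3) unfolding numeral_2_eq_2 .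
    then obtain x y where xG: "x \<in> lower_central G 0" and y: "y \<in> carrier G" "\<not> central (commutator x y)"
      by (rule exists_noncentral_commutator)
    then have x: "x \<in> carrier G" by simp
    then obtain w where "w \<in> carrier G" "commutator (commutator x y) w \<noteq> \<one>\<^bsub>G\<^esub>"
      using x y by (auto simp: central_def commutator_eq_one_iff)
    then obtain a b where ab: "a \<in> carrier G" "b \<in> carrier G"
      and ne: "commutator (commutator a b) b \<noteq> \<one>\<^bsub>G\<^esub>"
      using z0.engel_imp_triple_trivial[OF _ p(2)] x y(1) by blast
    define z where "z = commutator (commutator a b) b"
    have zK: "z \<in> z0.K" using z0.triple ab by (simp add: z_def)
    interpret central_prime G p z using z0.central_prime_of_K[OF zK] ne by (simp add: z_def)
    have KK: "K = z0.K" using z0.K_of_K[OF zK z_ne] .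
    interpret class3_central_prime G p z
      using z0.triple by unfold_locales (simp add: KK)
    have zD: "z \<in> lower_central G 1" using commutator_in_lower_central_1 ab by (simp add: z_def)
    note step = central_prime_step[OF central_prime_axioms zD Suc.prems(2,4,5)]
    show ?thesis
    proof (cases "p = 2 \<and> m = 2")
      case two: True
      have "order (schur_multiplier G) \<le> 2 ^ Suc k"
        by (rule schur_multiplier_bound_2_rank_2[OF Suc.prems(1,2)]) (use Suc.prems(4,5) two in auto)
      then show ?thesis using two by (simp add: numeral_2_eq_2)
    next
      case False
      have pos: "p > 0" using p1 by simp
      \<comment> \<open>For $m = 2$ a single value has to suffice; for $m \ge 3$ two values are few enough.\<close>
      have few: "card pairings \<le> p ^ (m - 1)"
      proof (cases "m = 2")
        case True
        then have "odd p" using False p(1) p1 prime_odd_nat[of p] by force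
        have "card pairings \<le> p"
          by (rule card_root_characters_le[OF pos pairings_root_characters ab(2)])
            (rule pairings_determined_class3_odd[OF z_def ab \<open>odd p\<close>])
        then show ?thesis using True by simp
      next
        case False
        have "card pairings \<le> p * p"
          by (rule card_root_characters_le_square[OF pos pairings_root_characters ab])
            (rule pairings_determined_class3[OF z_def ab])
        also have "\<dots> = p ^ 2" by (simp add: power2_eq_square)
        also have "\<dots> \<le> p ^ (m - 1)" using rank False p1 by (intro power_increasing) auto
        finally show ?thesis .
      qed
      \<comment> \<open>Here $|G'| = p^{k+1}$, so this says that $G'$ is larger than $K$ and $G/K$ is not abelian.\<close>
      have "k \<noteq> 0"
      proof
        assume "k = 0"
        then have c: "card (lower_central G 1) = p" using Suc.prems(5) by simp
        have fin: "finite (lower_central G 1)" using c pos by (metis card.infinite less_irrefl)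
        have "K \<subseteq> lower_central G 1" using K_subset_subgroup[OF lower_central_subgroup zD] .
        then have "K = lower_central G 1" using card_K c fin card_subset_eq by metis
        then have "central (commutator a b)" using commutator_in_lower_central_1 ab K_central by simp
        from commutator_central_left[OF this ab(2)] show False using z_ne z_def by simp
      qed
      then obtain l where l: "k = Suc l" by (cases k) auto
      have "order (schur_multiplier Q) \<le> p ^ ((m - 1 choose 2) + k * (m - 1) + 1)"
        using schur_multiplier_nonabelian_bound[OF p(1) step(1,2), of m l] step(3,4) unfolding l by blast
      then have "order (schur_multiplier G) * p \<le> p ^ ((m - 1 choose 2) + k * (m - 1) + 1) * p ^ (m - 1)"
        using step(6) few by (meson le_trans mult_le_mono)
      also have "\<dots> = p ^ ((m - 1 choose 2) + Suc k * (m - 1)) * p"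
      proof -
        obtain j where "m = Suc j" using rank by (cases m) auto
        then show ?thesis by (simp add: power_add)
      qed
      finally show ?thesis using rank p1 by simp
    qed
  qed
qed

lemma exponent_eq:
  assumes "2 \<le> m" "n = m + k"
  shows "1 / 2 * (real n + real k - 2) * (real n - real k - 1) = real ((m - 1 choose 2) + k * (m - 1))"
proof -
  obtain j where j: "m = Suc j" using assms(1) by (cases m) auto
  have "2 * real (j choose 2) = real j * (real j - 1)"
    by (induction j) (simp_all add: choose_two_Suc algebra_simps)
  then show ?thesis by (simp add: assms(2) j algebra_simps)
qed

text \<open>The induction lives on records without extension fields, so $G$ is replaced by its truncation, which
  has the same lower central series and the same multiplier.\<close>

lemma schur_multiplier_bound:
  fixes G :: "('a, 'b) monoid_scheme" (structure)
  assumes p: "prime p" "p \<noteq> 3" and G: "group G" and ord: "order G = p ^ n"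
    and nil: "has_nilpotency_class G c" "c \<ge> 3" and der: "card (derived G (carrier G)) = p ^ k"
  shows "real (order (schur_multiplier G)) \<le> real p powr (1 / 2 * (real n + real k - 2) * (real n - real k - 1))"
proof -
  interpret group G by fact
  define H where "H = \<lparr>carrier = carrier G, mult = mult G, one = one G\<rparr>"
  have H: "group H"
    by (rule groupI) (auto simp: H_def m_assoc intro: bexI[of _ "inv _"])
  have "group_hom G H id" using H
    by (auto simp: group_hom_def group_hom_axioms_def hom_def H_def is_group)
  then interpret id: group_hom G H id .
  have lc: "lower_central H i = lower_central G i" for i
    using id.lower_central_image by (simp add: H_def)
  have M: "schur_multiplier H = schur_multiplier G"
    unfolding schur_multiplier_def cocycle_group2_def coboundaries2_def coboundary2_def cocycles2_def H_def
    by simp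
  have p1: "p > 1" using p(1) prime_gt_1_nat by blast
  have "card (derived G (carrier G)) dvd card (carrier G)"
    by (rule card_subgroup_dvd[OF order_pos_finite[OF ord p(1)]])
      (simp_all add: derived_is_subgroup subgroup_self derived_in_carrier)
  then have "p ^ k dvd p ^ n" using ord der by (simp add: order_def)
  then have "k \<le> n" using p1 power_dvd_imp_le by blast
  then obtain m where m: "n = m + k" using le_Suc_ex by (metis add.commute)
  have c2: "2 < c" using nil(2) by simp
  have "lower_central H c = {\<one>\<^bsub>H\<^esub>}" "lower_central H 2 \<noteq> {\<one>\<^bsub>H\<^esub>}"
    using nil(1) c2 unfolding lc has_nilpotency_class_def by (auto simp: H_def simp del: lower_central.simps)
  moreover have "card (lower_central H 1) = p ^ k" using der lc[of 1] unfolding One_nat_def lower_central_1 by simp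
  moreover have "order H = p ^ (m + k)" using ord by (simp add: H_def order_def m)
  ultimately have b: "2 \<le> m" "order (schur_multiplier G) \<le> p ^ ((m - 1 choose 2) + k * (m - 1))"
    unfolding M[symmetric] using schur_multiplier_class_ge_3_bound[OF p H, of c m k] by blast+
  have "real (order (schur_multiplier G)) \<le> real (p ^ ((m - 1 choose 2) + k * (m - 1)))"
    using b(2) by (simp only: of_nat_le_iff)
  also have "\<dots> = real p powr real ((m - 1 choose 2) + k * (m - 1))"
    using p1 by (subst powr_realpow) simp_all
  finally show ?thesis unfolding exponent_eq[OF b(1) m] .
qed

theorem theorem1p1:
  fixes p :: nat
  assumes "prime p" and "p \<noteq> 3"
  shows "\<not> (\<exists>(G :: ('a, 'b) monoid_scheme) (n :: nat) (k :: nat) (c :: nat).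
            group G \<and> \<not> comm_group G \<and> order G = p ^ n \<and>
            has_nilpotency_class G c \<and> c \<ge> 3 \<and>
            card (derived G (carrier G)) = p ^ k \<and>
            real (order (schur_multiplier G)) =
              real p powr (1 / 2 * (real n + real k - 2) * (real n - real k - 1) + 1))
       \<and> (\<forall>(G :: ('a, 'b) monoid_scheme) (n :: nat) (k :: nat) (c :: nat).
            group G \<longrightarrow> order G = p ^ n \<longrightarrow>
            has_nilpotency_class G c \<longrightarrow> c \<ge> 3 \<longrightarrow>
            card (derived G (carrier G)) = p ^ k \<longrightarrow>
            real (order (schur_multiplier G)) \<le>
              real p powr (1 / 2 * (real n + real k - 2) * (real n - real k - 1)))"
proof (intro conjI allI impI notI)
  assume "\<exists>(G :: ('a, 'b) monoid_scheme) (n :: nat) (k :: nat) (c :: nat).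
            group G \<and> \<not> comm_group G \<and> order G = p ^ n \<and>
            has_nilpotency_class G c \<and> c \<ge> 3 \<and>
            card (derived G (carrier G)) = p ^ k \<and>
            real (order (schur_multiplier G)) =
              real p powr (1 / 2 * (real n + real k - 2) * (real n - real k - 1) + 1)"
  then obtain G :: "('a, 'b) monoid_scheme" and n k c where
    "group G" "order G = p ^ n" "has_nilpotency_class G c" "c \<ge> 3" "card (derived G (carrier G)) = p ^ k"
    and eq: "real (order (schur_multiplier G)) =
      real p powr (1 / 2 * (real n + real k - 2) * (real n - real k - 1) + 1)"
    by blast
  then have "real (order (schur_multiplier G)) \<le>
      real p powr (1 / 2 * (real n + real k - 2) * (real n - real k - 1))"
    by (intro schur_multiplier_bound[OF assms])
  moreover have "real p > 1" using prime_gt_1_nat[OF assms(1)] by simp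
  ultimately show False unfolding eq by (simp only: powr_le_cancel_iff)
next
  fix G :: "('a, 'b) monoid_scheme" and n k c :: nat
  assume "group G" "order G = p ^ n" "has_nilpotency_class G c" "c \<ge> 3"
    "card (derived G (carrier G)) = p ^ k"
  then show "real (order (schur_multiplier G)) \<le>
      real p powr (1 / 2 * (real n + real k - 2) * (real n - real k - 1))"
    by (rule schur_multiplier_bound[OF assms])
qed

end
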